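(* Let $a$ be a non-zero integer and let $E_a/\mathbb{Q}$ be the elliptic curve $y^2=x^3+ax$. For all points $P\in E_a(\mathbb{Q})$, $$-\frac14\log|a|-\frac{1}{2\sqrt{|a|}} < \frac12 h(P)-\widehat{h}(P) < \frac14\log|a|+\frac38\log 2.$$ Moreover, for all points $P\in E_a(\mathbb{Q})$ one also has the lower bound $$-\frac14\log|a|-0.16 < \frac12 h(P)-\widehat{h}(P).$$
   Context: For a rational number $s/t$ in lowest terms, $h(s/t)=\log\max\{|s|,|t|\}$ (so $h(0)=0$). For a point $P\in E_a(\mathbb{Q})$, $P\neq O$, put $h(P)=h(x(P))$, and $h(O)=0$. The canonical height is normalised as $\widehat{h}(P)=\frac12\lim_{n\to\infty} 4^{-n}h(2^nP)$. *)

theory Defs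
  imports Complex_Main
begin

datatype 'a ec_point = Infinity | Affine 'a 'a

text \<open>Points, with coordinates in the ground field, of the projective closure of
  \<open>y\<^sup>2 = x\<^sup>3 + a x\<close>; \<open>Infinity\<close> is the neutral element \<open>O\<close>.\<close>

definition ec_points :: "'a::field \<Rightarrow> 'a ec_point set" where
  "ec_points a = insert Infinity {Affine x y | x y. y ^ 2 = x ^ 3 + a * x}"

text \<open>The chord-tangent law. For points of the curve with \<open>x1 = x2\<close> one has
  \<open>y2 = y1\<close> or \<open>y2 = - y1\<close>, so the tangent case is reached exactly when the two points
  coincide and are not 2-torsion.\<close>

fun ec_add :: "'a::field \<Rightarrow> 'a ec_point \<Rightarrow> 'a ec_point \<Rightarrow> 'a ec_point" where
  "ec_add a Infinity Q = Q"
| "ec_add a P Infinity = P"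
| "ec_add a (Affine x1 y1) (Affine x2 y2) =
    (if x1 = x2 \<and> y1 = - y2 then Infinity
     else
       let m = (if x1 = x2 then (3 * x1 ^ 2 + a) / (2 * y1) else (y2 - y1) / (x2 - x1));
           x3 = m ^ 2 - x1 - x2
       in Affine x3 (m * (x1 - x3) - y1))"

fun ec_mult :: "'a::field \<Rightarrow> nat \<Rightarrow> 'a ec_point \<Rightarrow> 'a ec_point" where
  "ec_mult a 0 P = Infinity"
| "ec_mult a (Suc n) P = ec_add a P (ec_mult a n P)"

text \<open>\<open>quotient_of\<close> yields the representation in lowest terms with positive denominator.\<close>

definition rat_height :: "rat \<Rightarrow> real" where
  "rat_height r = (case quotient_of r of (s, t) \<Rightarrow> ln (real_of_int (max \<bar>s\<bar> \<bar>t\<bar>)))"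

fun naive_height :: "rat ec_point \<Rightarrow> real" where
  "naive_height Infinity = 0"
| "naive_height (Affine x y) = rat_height x"

definition canonical_height :: "rat \<Rightarrow> rat ec_point \<Rightarrow> real" where
  "canonical_height a P = 1 / 2 * lim (\<lambda>n. naive_height (ec_mult a (2 ^ n) P) / 4 ^ n)"

end

(*
  Duplication sends x = s/t to (s^2 - a t^2)^2 / (4 s t (s^2 + a t^2)), so both bounds follow from
  real functions of (s, t), comparable to max(|s|, |t|), that change in a controlled way under
  this map.

  Lower bounds: G = |s| + sqrt|a| t satisfies G(2P) <= G(P)^4, so log G(2^n P) / 4^n decreases to
  twice the canonical height. For small |a| this is replaced by s^2 + |a| t^2 (a < 0), by one
  explicit duplication (a >= 3), or by a descent showing that every rational point is 2-torsion
  (a = 1, 2, -1).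

  Upper bound: in terms of x^2/a = b/c, duplication is (b, c) -> ((b - c)^4, 16 b c (b + c)^2), and
  |b| + |c| grows at least to the fourth power up to the common factor, which divides 64 at the
  first step and is 1 afterwards.

  The doubling relation for ec_mult needs associativity of the chord-tangent law. It is proved for
  a generic third point by comparing functions x^2 + al x + be - ga y with prescribed zeros, and
  extended by adding an auxiliary point and cancelling; over the rationals, the auxiliary point is
  taken among the infinitely many real points.
*)
theory Submission
  imports Defs "HOL-Computational_Algebra.Nth_Powers"
begin

section \<open>The group law\<close>

text \<open>Write m = max(|s|, |t|) and L = lim ln m(2^n P) / 4^n, which is twice the canonical
  height; every claim compares ln m(P) with L. Since log G(2^n P) / 4^n decreases, L <= ln G(P) <=
  ln m(P) + ln(1 + sqrt|a|), and ln(1 + z) < z at z = 1/sqrt|a| yields both the term 1/(2 sqrt|a|)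
  and strictness. In the upper bound, cancelling up to 64 at the first duplication costs (ln 64)/16
  = 3/8 ln 2, and the gcd of s^2 and a t^2 costs (ln|a|)/4. The constant 0.16 exceeds ln(27/4)/12,
  which arises for a <= -2, and ln(3.579)/8, which arises for a >= 3. Associativity serves only to
  obtain 2^(n+1) P = 2^n P + 2^n P, because \<open>ec_mult\<close> adds P one copy at a time. The
  group E_a(Q) may be finite and then need not contain a point avoiding the finitely many exceptions
  of the generic argument; hence the detour through real points.\<close>

fun ec_neg :: "'a::field ec_point \<Rightarrow> 'a ec_point" where
  "ec_neg Infinity = Infinity"
| "ec_neg (Affine x y) = Affine x (- y)"

lemma ec_neg_neg [simp]: "ec_neg (ec_neg P) = P"
  by (cases P) auto

lemma ec_points_neg [simp]: "ec_neg P \<in> ec_points a \<longleftrightarrow> P \<in> ec_points a"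
  by (cases P) (auto simp: ec_points_def)

lemma Infinity_in_ec_points [simp]: "Infinity \<in> ec_points a"
  by (simp add: ec_points_def)

lemma Affine_in_ec_points: "Affine x y \<in> ec_points a \<longleftrightarrow> y ^ 2 = x ^ 3 + a * x"
  by (auto simp: ec_points_def)

lemma ec_add_Infinity_right [simp]: "ec_add a P Infinity = P"
  by (cases P) auto

text \<open>Vieta's relations for the abscissae of the intersection of the curve with \<open>y = l x + v\<close>.\<close>

definition chord :: "'a::field \<Rightarrow> 'a \<Rightarrow> 'a \<Rightarrow> 'a \<Rightarrow> 'a \<Rightarrow> 'a \<Rightarrow> bool" where
  "chord a l v x1 x2 x3 \<longleftrightarrow> x1 + x2 + x3 = l ^ 2 \<and>
     x1 * x2 + x1 * x3 + x2 * x3 = a - 2 * l * v \<and> x1 * x2 * x3 = v ^ 2"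

text \<open>The relation P + Q + R = O. Vieta's relations count intersections with multiplicity, so
  chords and tangents need no case distinction. Its symmetry in the three points is the source of
  commutativity and cancellation.\<close>

fun collinear3 :: "'a::field \<Rightarrow> 'a ec_point \<Rightarrow> 'a ec_point \<Rightarrow> 'a ec_point \<Rightarrow> bool" where
  "collinear3 a Infinity Q R = (R = ec_neg Q)"
| "collinear3 a P Infinity R = (R = ec_neg P)"
| "collinear3 a P Q Infinity = (Q = ec_neg P)"
| "collinear3 a (Affine x1 y1) (Affine x2 y2) (Affine x3 y3) =
     (\<exists>l v. chord a l v x1 x2 x3 \<and> y1 = l * x1 + v \<and> y2 = l * x2 + v \<and> y3 = l * x3 + v)"

lemma chord_perm: "chord a l v x1 x2 x3 = chord a l v x2 x1 x3"
  "chord a l v x1 x2 x3 = chord a l v x1 x3 x2"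
  by (auto simp: chord_def algebra_simps)

lemma collinear3_swap12: "collinear3 a P Q R = collinear3 a Q P R"
  by (cases P; cases Q; cases R) (auto simp: chord_perm(1))

lemma collinear3_swap23: "collinear3 a P Q R = collinear3 a P R Q"
  by (cases P; cases Q; cases R) (auto simp: chord_perm(2))

lemma collinear3_neg:
  assumes "collinear3 a P Q R"
  shows "collinear3 a (ec_neg P) (ec_neg Q) (ec_neg R)"
proof -
  have *: "\<exists>l' v'. chord a l' v' x1 x2 x3 \<and> - (l * x1 + v) = l' * x1 + v' \<and>
      - (l * x2 + v) = l' * x2 + v' \<and> - (l * x3 + v) = l' * x3 + v'"
    if "chord a l v x1 x2 x3" for l v x1 x2 x3
    by (rule exI[of _ "- l"], rule exI[of _ "- v"]) (use that in \<open>auto simp: chord_def\<close>)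
  show ?thesis
    using assms by (cases P; cases Q; cases R) (auto intro: *)
qed

lemma chord_factor:
  assumes "chord a l v x1 x2 x3"
  shows "x ^ 3 + a * x - (l * x + v) ^ 2 = (x - x1) * (x - x2) * (x - x3)"
  using assms unfolding chord_def by algebra

lemma chord_on_curve:
  assumes "chord a l v x1 x2 x3" "x \<in> {x1, x2, x3}" "y = l * x + v"
  shows "y ^ 2 = x ^ 3 + a * x"
  using chord_factor[OF assms(1), of x] assms(2,3) by auto

lemma collinear3_closed:
  assumes "collinear3 a P Q R" "P \<in> ec_points a" "Q \<in> ec_points a"
  shows "R \<in> ec_points a"
  using assms
  by (cases P; cases Q; cases R) (auto simp: Affine_in_ec_points intro: chord_on_curve)

locale elliptic =
  fixes a :: "'a::field_char_0"
  assumes nonsingular: "a \<noteq> 0"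
begin

abbreviation add (infixl "\<oplus>" 65) where "P \<oplus> Q \<equiv> ec_add a P Q"
abbreviation E where "E \<equiv> ec_points a"

lemma chord_tangent:
  assumes "chord a l v x x x3"
  shows "3 * x ^ 2 + a = 2 * l * (l * x + v)"
  using assms unfolding chord_def by algebra

text \<open>At a point with y = 0 the gradient of the curve equation is (3 x^2 + a, 0) up to sign;
  being nonzero, it makes the tangent there vertical.\<close>

lemma two_torsion_smooth:
  assumes "0 = x ^ 3 + a * x"
  shows "3 * x ^ 2 + a \<noteq> 0"
proof
  assume "3 * x ^ 2 + a = 0"
  then have "a = - 3 * x ^ 2" by algebra
  with assms have "2 * x ^ 3 = 0" by algebra
  then have "x = 0" by simp
  with \<open>a = _\<close> nonsingular show False by simp
qed

lemma collinear3_add: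
  assumes "P \<in> E" "Q \<in> E"
  shows "collinear3 a P Q (ec_neg (P \<oplus> Q))"
proof (cases P; cases Q)
  fix x1 y1 x2 y2
  assume P: "P = Affine x1 y1" and Q: "Q = Affine x2 y2"
  have c: "y1 ^ 2 = x1 ^ 3 + a * x1" "y2 ^ 2 = x2 ^ 3 + a * x2"
    using assms P Q by (auto simp: Affine_in_ec_points)
  show ?thesis
  proof (cases "x1 = x2 \<and> y1 = - y2")
    case True
    then show ?thesis using P Q by simp
  next
    case False
    define m where "m = (if x1 = x2 then (3 * x1 ^ 2 + a) / (2 * y1) else (y2 - y1) / (x2 - x1))"
    define x3 where "x3 = m ^ 2 - x1 - x2"
    define v where "v = y1 - m * x1"
    have add: "P \<oplus> Q = Affine x3 (m * (x1 - x3) - y1)"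
      using False P Q by (simp add: m_def x3_def Let_def)
    have "y2 = m * x2 + v \<and> chord a m v x1 x2 x3"
    proof (cases "x1 = x2")
      case True
      then have "y1 ^ 2 = y2 ^ 2" using c by simp
      with False True have y: "y1 = y2" by (auto simp: power2_eq_iff)
      have "y1 \<noteq> 0" using False True y by auto
      then have m: "2 * y1 * m = 3 * x1 ^ 2 + a" using True by (simp add: m_def)
      show ?thesis unfolding chord_def
      proof (intro conjI)
        show "y2 = m * x2 + v" using True y v_def by simp
        show "x1 + x2 + x3 = m\<^sup>2" using x3_def by simp
        show "x1 * x2 + x1 * x3 + x2 * x3 = a - 2 * m * v"
          using m unfolding x3_def v_def True[symmetric] by algebra
        show "x1 * x2 * x3 = v\<^sup>2"
          using m c(1) unfolding x3_def v_def True[symmetric] by algebra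
      qed
    next
      case xne: False
      then have m: "m * (x2 - x1) = y2 - y1" by (simp add: m_def)
      have d: "x2 - x1 \<noteq> 0" using xne by simp
      \<comment> \<open>With this factor the second Vieta relation is the difference of the two
        curve equations, once y is replaced by the line.\<close>
      have "(x2 - x1) * (x1 * x2 + x1 * x3 + x2 * x3) = (x2 - x1) * (a - 2 * m * v)"
        using m c unfolding x3_def v_def by algebra
      then have e2: "x1 * x2 + x1 * x3 + x2 * x3 = a - 2 * m * v" using d by simp
      have e3: "x1 * x2 * x3 = v\<^sup>2" using c(1) e2 unfolding x3_def v_def by algebra
      have "y2 = m * x2 + v" using m unfolding v_def by algebra
      with e2 e3 show ?thesis unfolding chord_def using x3_def by simp
    qed
    then have "chord a m v x1 x2 x3 \<and> y1 = m * x1 + v \<and> y2 = m * x2 + v \<and>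
        - (m * (x1 - x3) - y1) = m * x3 + v"
      by (simp add: v_def algebra_simps)
    then show ?thesis unfolding add unfolding P Q ec_neg.simps collinear3.simps by blast
  qed
qed auto

lemma collinear3_unique:
  assumes "P \<in> E" "Q \<in> E" "collinear3 a P Q R" "collinear3 a P Q R'"
  shows "R = R'"
proof (cases P; cases Q)
  fix x1 y1 x2 y2
  assume P: "P = Affine x1 y1" and Q: "Q = Affine x2 y2"
  have c: "y1 ^ 2 = x1 ^ 3 + a * x1" "y2 ^ 2 = x2 ^ 3 + a * x2"
    using assms P Q by (auto simp: Affine_in_ec_points)
  \<comment> \<open>A line y = l x + v through P and -P forces y1 = 0, and the double root then
    makes it tangent at a 2-torsion point, where the tangent is vertical.\<close>
  have neg: False if "chord a l v x1 x2 x3" "y1 = l * x1 + v" "y2 = l * x2 + v" "x1 = x2" "y1 = - y2"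
    for l v x3
  proof -
    have "y1 = 0" using that by (metis eq_neg_iff_add_eq_0 mult_2 mult_eq_0_iff zero_neq_numeral)
    then show False
      using chord_tangent[of l v x1 x3] that two_torsion_smooth[of x1] c by auto
  qed
  have slope: "l = l' \<and> v = v'" if A: "chord a l v x1 x2 x3" "y1 = l * x1 + v" "y2 = l * x2 + v"
    "chord a l' v' x1 x2 x3'" "y1 = l' * x1 + v'" "y2 = l' * x2 + v'" for l v x3 l' v' x3'
  proof (cases "x1 = x2")
    case True
    have "y1 = - y2" if "y1 = 0" using that True A(2,3) by simp
    then have "y1 \<noteq> 0" using neg[OF A(1-3) True] by auto
    have "2 * l * y1 = 2 * l' * y1"
      using chord_tangent[of l v x1 x3] chord_tangent[of l' v' x1 x3'] A True by auto
    with \<open>y1 \<noteq> 0\<close> have "l = l'" by simp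
    then show ?thesis using A by simp
  next
    case False
    have "(l - l') * (x1 - x2) = 0" using A(2,3,5,6) by algebra
    with False have "l = l'" by simp
    then show ?thesis using A by simp
  qed
  have x3: "x3 = x3'" if "chord a l v x1 x2 x3" "chord a l v x1 x2 x3'" for l v x3 x3'
    using that unfolding chord_def by (metis add_left_cancel)
  have col: "\<exists>l v x3. chord a l v x1 x2 x3 \<and> S = Affine x3 (l * x3 + v) \<and>
      y1 = l * x1 + v \<and> y2 = l * x2 + v"
    if "collinear3 a P Q S" "S \<noteq> Infinity" for S
    using that P Q by (cases S) auto
  have inf: "x1 = x2 \<and> y1 = - y2" if "collinear3 a P Q Infinity"
    using that P Q by auto
  show ?thesis
  proof (cases "R = Infinity \<or> R' = Infinity")
    case True
    then have "x1 = x2 \<and> y1 = - y2" using inf assms(3,4) by blast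
    then show ?thesis using col[OF assms(3)] col[OF assms(4)] neg by metis
  next
    case False
    then show ?thesis using col[OF assms(3)] col[OF assms(4)] slope x3 by metis
  qed
qed (use assms in auto)

lemma collinear3_iff:
  assumes "P \<in> E" "Q \<in> E"
  shows "collinear3 a P Q R \<longleftrightarrow> R = ec_neg (P \<oplus> Q)"
  using collinear3_add[OF assms] collinear3_unique[OF assms] by blast

lemma add_closed [simp]:
  assumes "P \<in> E" "Q \<in> E"
  shows "P \<oplus> Q \<in> E"
  using collinear3_closed[OF collinear3_add[OF assms] assms] by simp

lemma add_commute:
  assumes "P \<in> E" "Q \<in> E"
  shows "P \<oplus> Q = Q \<oplus> P"
  using collinear3_add[OF assms] assms collinear3_iff[of Q P]
  by (metis collinear3_swap12 ec_neg_neg)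

lemma neg_add:
  assumes "P \<in> E" "Q \<in> E"
  shows "ec_neg (P \<oplus> Q) = ec_neg P \<oplus> ec_neg Q"
  using collinear3_neg[OF collinear3_add[OF assms]] assms
  by (simp add: collinear3_iff)

text \<open>This instance of associativity needs no computation: the collinear triple P, Q, -(P + Q)
  may be permuted. It suffices for cancelling auxiliary points before associativity is
  known.\<close>

lemma add_cancel_right [simp]:
  assumes "P \<in> E" "Q \<in> E"
  shows "(P \<oplus> Q) \<oplus> ec_neg Q = P"
proof -
  have "collinear3 a (ec_neg (P \<oplus> Q)) Q P"
    using collinear3_add[OF assms] collinear3_swap12 collinear3_swap23 by metis
  then have "P = ec_neg (ec_neg (P \<oplus> Q) \<oplus> Q)"
    using assms by (simp add: collinear3_iff)
  then show ?thesis using assms by (simp add: neg_add)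
qed

lemma add_neg_self [simp]: "ec_neg P \<oplus> P = Infinity" "P \<oplus> ec_neg P = Infinity"
  by (cases P; simp)+

lemma add_eq_Infinity_iff:
  assumes "P \<in> E" "Q \<in> E"
  shows "P \<oplus> Q = Infinity \<longleftrightarrow> P = ec_neg Q"
  using assms add_cancel_right[of P Q] by (metis add_neg_self(1) ec_add.simps(1))

end

declare ec_add.simps(3) [simp del]

section \<open>Associativity of the chord-tangent law\<close>

context elliptic
begin

text \<open>With \<open>C = - (A + B)\<close>, the product of the lines through \<open>A, B, C\<close> and \<open>- C, T, D\<close>, divided by
  the vertical line through \<open>C\<close>, is a function \<open>x\<^sup>2 + al x + be - ga y\<close> whose divisor of zeros is
  \<open>A + B + T + D\<close>. It is determined by \<open>A, B, T\<close>, hence so is \<open>D = - ((A + B) + T)\<close>.\<close>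

lemma assoc_conic:
  assumes C: "chord a l v x1 x2 xc" and D: "chord a m w xc x3 xd"
    and y: "y1 = l * x1 + v" "y2 = l * x2 + v" "m * xc + w = - (l * xc + v)" "y3 = m * x3 + w"
      "yd = m * xd + w"
    and defs: "al = xc + l * m" "ga = l + m" "be = x1 * x2 + ga * v"
  shows "x1 ^ 2 + al * x1 + be = ga * y1" "x2 ^ 2 + al * x2 + be = ga * y2"
    "x3 ^ 2 + al * x3 + be = ga * y3" "xd ^ 2 + al * xd + be = ga * yd"
    "xd = ga ^ 2 - 2 * al - x1 - x2 - x3"
    "x1 = x3 \<Longrightarrow> y1 = y3 \<Longrightarrow> 2 * y1 * (2 * x1 + al) = ga * (3 * x1 ^ 2 + a)"
proof -
  have be: "be = x3 * xd + ga * w"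
    using C D y(3) defs unfolding chord_def by algebra
  show "x1 ^ 2 + al * x1 + be = ga * y1" "x2 ^ 2 + al * x2 + be = ga * y2"
    using C y(1,2) defs unfolding chord_def by algebra+
  show "x3 ^ 2 + al * x3 + be = ga * y3" "xd ^ 2 + al * xd + be = ga * yd"
    using D y(4,5) defs(1,2) be unfolding chord_def by algebra+
  show "xd = ga ^ 2 - 2 * al - x1 - x2 - x3"
    using C D defs(1,2) unfolding chord_def by algebra
  \<comment> \<open>Where two prescribed zeros coincide, the conic is tangent to the curve; this
    condition replaces the missing second interpolation condition when A = B.\<close>
  assume e: "x1 = x3" "y1 = y3"
  have m: "m * (x1 - xc) = 2 * v + l * x1 + l * xc" using y(1,3,4) e by algebra
  have q: "(x1 - xc) * (2 * x1 + al) = 3 * x1 ^ 2 + a"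
    using C defs(1) m unfolding chord_def by algebra
  have "2 * y1 = ga * (x1 - xc)" using y(1,3,4) e defs(2) by algebra
  then show "2 * y1 * (2 * x1 + al) = ga * (3 * x1 ^ 2 + a)" using q by algebra
qed

text \<open>Each bracketing produces a conic through A, B, T whose fourth zero is the negative of
  the sum. It is enough that the two conics coincide.\<close>

lemma add_assoc_generic_aux:
  assumes A: "Affine x1 y1 \<in> E" and B: "Affine x2 y2 \<in> E" and T: "Affine x3 y3 \<in> E"
    and ne: "x3 \<noteq> x1" "x3 \<noteq> x2"
    and AB: "x1 \<noteq> x2 \<or> y1 = y2 \<and> y1 \<noteq> 0"
  shows "(Affine x1 y1 \<oplus> Affine x2 y2) \<oplus> Affine x3 y3 = Affine x1 y1 \<oplus> (Affine x2 y2 \<oplus> Affine x3 y3)"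
    (is "(?A \<oplus> ?B) \<oplus> ?T = _")
proof (cases "?T = ec_neg (?A \<oplus> ?B)")
  case True
  then have "collinear3 a ?A ?B ?T" using A B by (simp add: collinear3_iff)
  then have "collinear3 a ?B ?T ?A" using collinear3_swap12 collinear3_swap23 by metis
  then have "?A = ec_neg (?B \<oplus> ?T)" using collinear3_iff[OF B T] by blast
  then show ?thesis using True by (metis add_neg_self ec_neg_neg)
next
  case False
  have notcol: "\<not> collinear3 a ?A ?B ?T" using collinear3_iff[OF A B] False by blast
  have AB0: "?A \<oplus> ?B \<noteq> Infinity"
    using AB A B by (auto simp: add_eq_Infinity_iff)
  have BT0: "?B \<oplus> ?T \<noteq> Infinity"
    using ne T B by (auto simp: add_eq_Infinity_iff)
  have ABT0: "(?A \<oplus> ?B) \<oplus> ?T \<noteq> Infinity"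
    using False A B T add_commute[of "?A \<oplus> ?B" ?T] add_eq_Infinity_iff[of ?T "?A \<oplus> ?B"] by auto
  have BTA0: "(?B \<oplus> ?T) \<oplus> ?A \<noteq> Infinity"
  proof
    assume "(?B \<oplus> ?T) \<oplus> ?A = Infinity"
    then have "?B \<oplus> ?T = ec_neg ?A" using A B T by (subst (asm) add_eq_Infinity_iff) auto
    then have "collinear3 a ?B ?T ?A" using B T by (subst collinear3_iff) (auto simp: ec_neg_neg)
    then show False using notcol collinear3_swap12 collinear3_swap23 by metis
  qed
  obtain xc yc where C: "?A \<oplus> ?B = Affine xc (- yc)"
    using AB0 by (metis ec_point.exhaust minus_minus)
  obtain xd yd where D: "(?A \<oplus> ?B) \<oplus> ?T = Affine xd (- yd)"
    using ABT0 by (metis ec_point.exhaust minus_minus)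
  obtain xc' yc' where C': "?B \<oplus> ?T = Affine xc' (- yc')"
    using BT0 by (metis ec_point.exhaust minus_minus)
  obtain xd' yd' where D': "(?B \<oplus> ?T) \<oplus> ?A = Affine xd' (- yd')"
    using BTA0 by (metis ec_point.exhaust minus_minus)
  have "collinear3 a ?A ?B (Affine xc yc)" "collinear3 a (Affine xc (- yc)) ?T (Affine xd yd)"
    "collinear3 a ?B ?T (Affine xc' yc')" "collinear3 a (Affine xc' (- yc')) ?A (Affine xd' yd')"
    using collinear3_add[OF A B] collinear3_add[OF add_closed[OF A B] T]
      collinear3_add[OF B T] collinear3_add[OF add_closed[OF B T] A]
    unfolding D D' unfolding C C' by simp_all
  then obtain l v m w l' v' m' w' where
    c1: "chord a l v x1 x2 xc" "y1 = l * x1 + v" "y2 = l * x2 + v" "yc = l * xc + v" and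
    c2: "chord a m w xc x3 xd" "- yc = m * xc + w" "y3 = m * x3 + w" "yd = m * xd + w" and
    c3: "chord a l' v' x2 x3 xc'" "y2 = l' * x2 + v'" "y3 = l' * x3 + v'" "yc' = l' * xc' + v'" and
    c4: "chord a m' w' xc' x1 xd'" "- yc' = m' * xc' + w'" "y1 = m' * x1 + w'" "yd' = m' * xd' + w'"
    by auto
  define al ga be where abg: "al = xc + l * m" "ga = l + m" "be = x1 * x2 + ga * v"
  define al' ga' be' where abg': "al' = xc' + l' * m'" "ga' = l' + m'" "be' = x2 * x3 + ga' * v'"
  have f1: "m * xc + w = - (l * xc + v)" using c1(4) c2(2) by simp
  have f2: "m' * xc' + w' = - (l' * xc' + v')" using c3(4) c4(2) by simp
  note f = assoc_conic[OF c1(1) c2(1) c1(2,3) f1 c2(3,4) abg]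
  note f' = assoc_conic[OF c3(1) c4(1) c3(2,3) f2 c4(3,4) abg']
  have Toff: "y3 \<noteq> l * x3 + v"
  proof
    assume y3: "y3 = l * x3 + v"
    have "y3 ^ 2 = x3 ^ 3 + a * x3" using T by (simp add: Affine_in_ec_points)
    then have "(x3 - x1) * (x3 - x2) * (x3 - xc) = 0"
      using chord_factor[OF c1(1), of x3] y3 by simp
    with ne have "x3 = xc" by simp
    then have "collinear3 a ?A ?B ?T"
      using c1 y3 by auto
    with notcol show False ..
  qed
  \<comment> \<open>The x^2 terms cancel in the difference of the two conics, leaving a linear form
    that vanishes at A and B (doubly if A = B), hence a multiple of the line AB. It also vanishes at
    T, which is off that line by \<open>Toff\<close>, so it is zero. If \<open>ga\<close> were 0, a
    monic quadratic in x alone would have three roots with multiplicity; \<open>ga\<close> must be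
    nonzero to recover the ordinate of the fourth zero.\<close>
  have main: "al = al' \<and> be = be' \<and> ga = ga' \<and> ga \<noteq> 0"
  proof (cases "x1 = x2")
    case False
    have "(x1 - x2) * ((al - al') - (ga - ga') * l) = 0"
      using f(1,2) f'(1,4) f'(1,2,3) c1(2,3) by algebra
    with False have al: "al - al' = (ga - ga') * l" by simp
    have "(ga - ga') * (y3 - (l * x3 + v)) = 0"
      using f(1,3) f'(2,3) c1(2) al by algebra
    with Toff have "ga = ga'" by simp
    moreover from this al have "al = al'" by simp
    ultimately have "be = be'" using f(1) f'(3) by (metis add_left_cancel)
    have "ga \<noteq> 0"
    proof
      assume "ga = 0"
      then have "(x1 - x2) * (x1 + x2 + al) = 0" "(x1 - x3) * (x1 + x3 + al) = 0"
        using f(1,2,3) by algebra+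
      with False ne have "x1 + x2 + al = 0" "x1 + x3 + al = 0" by auto
      then have "x2 = x3" by (metis add.assoc add.commute add_left_cancel)
      with ne show False by simp
    qed
    then show ?thesis using \<open>ga = ga'\<close> \<open>al = al'\<close> \<open>be = be'\<close> by simp
  next
    case True
    with AB have y: "y1 = y2" "y1 \<noteq> 0" by auto
    have tl: "3 * x1 ^ 2 + a = 2 * l * y1"
      using chord_tangent[of l v x1 xc] c1 True by simp
    have t: "2 * x1 + al = ga * l"
      using c1(1) abg(1,2) True unfolding chord_def by algebra
    have "2 * y1 * (2 * x1 + al') = ga' * (3 * x1 ^ 2 + a)"
      using f'(6) True y by simp
    then have "2 * y1 * (2 * x1 + al') = 2 * y1 * (ga' * l)" using tl by algebra
    with y have t': "2 * x1 + al' = ga' * l" by simp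
    have al: "al - al' = (ga - ga') * l" using t t' by algebra
    have "(ga - ga') * (y3 - (l * x3 + v)) = 0"
      using f(1,3) f'(2,3) c1(2) al by algebra
    with Toff have "ga = ga'" by simp
    moreover from this al have "al = al'" by simp
    ultimately have "be = be'" using f(1) f'(3) by (metis add_left_cancel)
    have "ga \<noteq> 0"
    proof
      assume "ga = 0"
      then have "(x1 - x3) * (x1 + x3 + al) = 0" "2 * x1 + al = 0"
        using f(1,3) t by algebra+
      with ne have "x1 + x3 + al = 0" "2 * x1 + al = 0" by auto
      then have "x1 = x3" by algebra
      with ne show False by simp
    qed
    then show ?thesis using \<open>ga = ga'\<close> \<open>al = al'\<close> \<open>be = be'\<close> by simp
  qed
  have "xd = xd'" using f(5) f'(5) main by simp
  moreover from this have "ga * yd = ga * yd'" using f(4) f'(4) main by metis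
  ultimately have "Affine xd (- yd) = Affine xd' (- yd')" using main by (metis mult_left_cancel)
  then have "(?A \<oplus> ?B) \<oplus> ?T = (?B \<oplus> ?T) \<oplus> ?A" using D D' by simp
  then show ?thesis using A B T add_commute[of "?B \<oplus> ?T" ?A] by simp
qed

lemma add_assoc_generic:
  assumes E: "A \<in> E" "B \<in> E" "T \<in> E"
    and T: "T \<notin> {A, B, ec_neg A, ec_neg B}"
  shows "(A \<oplus> B) \<oplus> T = A \<oplus> (B \<oplus> T)"
proof (cases "A = ec_neg B")
  case True
  then show ?thesis
    using E add_commute[of "ec_neg B" "B \<oplus> T"] add_commute[of B T] by simp
next
  case False
  have eq: "Affine x y = Affine x' y' \<or> Affine x y = Affine x' (- y')"
    if "Affine x y \<in> E" "Affine x' y' \<in> E" "x = x'" for x y x' y'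
  proof -
    have "y ^ 2 = y' ^ 2" using that by (simp add: Affine_in_ec_points)
    then show ?thesis using that by (auto simp: power2_eq_iff)
  qed
  show ?thesis
  proof (cases A; cases B; cases T)
    fix x1 y1 x2 y2 x3 y3
    assume P: "A = Affine x1 y1" "B = Affine x2 y2" "T = Affine x3 y3"
    have "x3 \<noteq> x1" "x3 \<noteq> x2"
      using eq[of x3 y3 x1 y1] eq[of x3 y3 x2 y2] E T P by auto
    moreover have "x1 \<noteq> x2 \<or> y1 = y2 \<and> y1 \<noteq> 0"
      using eq[of x1 y1 x2 y2] E False P by auto
    ultimately show ?thesis
      using add_assoc_generic_aux E P by simp
  qed auto
qed

lemma add_assoc:
  assumes inf: "infinite E" and E: "A \<in> E" "B \<in> E" "C \<in> E"
  shows "(A \<oplus> B) \<oplus> C = A \<oplus> (B \<oplus> C)"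
proof -
  define F where "F P Q = {P, Q, ec_neg P, ec_neg Q}" for P Q :: "'a ec_point"
  have g: "(P \<oplus> Q) \<oplus> T = P \<oplus> (Q \<oplus> T)" if "P \<in> E" "Q \<in> E" "T \<in> E" "T \<notin> F P Q" for P Q T
    using add_assoc_generic that unfolding F_def by blast
  \<comment> \<open>The exceptions for four uses of \<open>g\<close>. The last set turns the
    requirement that C + T avoid \<open>F A B\<close> into a condition on T, by cancelling
    C.\<close>
  define S where "S = F (A \<oplus> B) C \<union> F B C \<union> F A (B \<oplus> C) \<union> (\<lambda>X. X \<oplus> ec_neg C) ` F A B"
  have "finite S" by (simp add: S_def F_def)
  with inf obtain T where T: "T \<in> E" "T \<notin> S"
    by (meson finite_subset subsetI)
  have CT: "C \<oplus> T \<notin> F A B"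
  proof
    assume "C \<oplus> T \<in> F A B"
    then have "(T \<oplus> C) \<oplus> ec_neg C \<in> (\<lambda>X. X \<oplus> ec_neg C) ` F A B"
      using add_commute[of C T] E T by (metis imageI)
    then show False using T E by (simp add: S_def)
  qed
  have "((A \<oplus> B) \<oplus> C) \<oplus> T = (A \<oplus> B) \<oplus> (C \<oplus> T)"
    using T E by (intro g) (auto simp: S_def)
  also have "\<dots> = A \<oplus> (B \<oplus> (C \<oplus> T))"
    using T E CT by (intro g) auto
  also have "B \<oplus> (C \<oplus> T) = (B \<oplus> C) \<oplus> T"
    using T E by (intro g[symmetric]) (auto simp: S_def)
  also have "A \<oplus> ((B \<oplus> C) \<oplus> T) = (A \<oplus> (B \<oplus> C)) \<oplus> T"
    using T E by (intro g[symmetric]) (auto simp: S_def)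
  finally have "((A \<oplus> B) \<oplus> C) \<oplus> T \<oplus> ec_neg T = (A \<oplus> (B \<oplus> C)) \<oplus> T \<oplus> ec_neg T"
    by simp
  then show ?thesis using E T by simp
qed

end

section \<open>Associativity over the rationals, by embedding into real points\<close>

lemma infinite_real_ec_points: "infinite (ec_points (a :: real))"
proof
  assume fin: "finite (ec_points a)"
  have "(\<lambda>x. Affine x (sqrt (x ^ 3 + a * x))) ` {1 + \<bar>a\<bar>..} \<subseteq> ec_points a"
  proof safe
    fix x assume "1 + \<bar>a\<bar> \<le> x"
    then have x: "1 \<le> x" "\<bar>a\<bar> \<le> x" by auto
    then have "x * 1 \<le> x * x" by (intro mult_left_mono) auto
    then have "0 \<le> x ^ 2 + a" using x unfolding power2_eq_square by linarith
    then have "0 \<le> x * (x ^ 2 + a)" using x by simp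
    then have "0 \<le> x ^ 3 + a * x" by (simp add: algebra_simps power3_eq_cube power2_eq_square)
    then show "Affine x (sqrt (x ^ 3 + a * x)) \<in> ec_points a"
      by (simp add: Affine_in_ec_points)
  qed
  then have "finite ((\<lambda>x. Affine x (sqrt (x ^ 3 + a * x))) ` {1 + \<bar>a\<bar>..})"
    using fin finite_subset by blast
  then have "finite {1 + \<bar>a\<bar>..}"
    by (rule finite_imageD) (simp add: inj_on_def)
  then show False using infinite_Ici by blast
qed

abbreviation real_point :: "rat ec_point \<Rightarrow> real ec_point" where
  "real_point \<equiv> map_ec_point of_rat"

lemma real_point_inject: "real_point P = real_point Q \<longleftrightarrow> P = Q"
  by (cases P; cases Q) (auto simp: of_rat_eq_iff)

lemma real_point_in_ec_points:
  "P \<in> ec_points a \<Longrightarrow> real_point P \<in> ec_points (of_rat a)"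
  by (cases P) (auto simp: Affine_in_ec_points simp flip: of_rat_power of_rat_mult of_rat_add)

lemma real_point_add:
  "real_point (ec_add a P Q) = ec_add (of_rat a) (real_point P) (real_point Q)"
proof (cases P; cases Q)
  fix x1 y1 x2 y2 assume "P = Affine x1 y1" "Q = Affine x2 y2"
  moreover have "of_rat y1 = - (of_rat y2 :: real) \<longleftrightarrow> y1 = - y2"
    by (metis of_rat_eq_iff of_rat_minus)
  ultimately show ?thesis
    by (auto simp: ec_add.simps(3) Let_def of_rat_eq_iff of_rat_add of_rat_diff of_rat_mult of_rat_divide
        of_rat_power of_rat_minus)
qed auto

locale rat_elliptic = elliptic a for a :: rat
begin

lemma add_assoc_rat:
  assumes "P \<in> E" "Q \<in> E" "R \<in> E"
  shows "P \<oplus> Q \<oplus> R = P \<oplus> (Q \<oplus> R)"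
proof -
  interpret R: elliptic "of_rat a :: real" by standard (use nonsingular in auto)
  have "real_point (P \<oplus> Q \<oplus> R) = real_point (P \<oplus> (Q \<oplus> R))"
    unfolding real_point_add
    by (rule R.add_assoc) (use infinite_real_ec_points in \<open>auto intro: real_point_in_ec_points assms\<close>)
  then show ?thesis by (simp add: real_point_inject)
qed

lemma ec_mult_closed: "P \<in> E \<Longrightarrow> ec_mult a n P \<in> E"
  by (induction n) auto

lemma ec_mult_add:
  assumes "P \<in> E"
  shows "ec_mult a (m + n) P = ec_mult a m P \<oplus> ec_mult a n P"
  by (induction m) (auto simp: add_assoc_rat ec_mult_closed assms)

lemma ec_mult_double:
  assumes "P \<in> E"
  shows "ec_mult a (2 ^ Suc n) P = ec_mult a (2 ^ n) P \<oplus> ec_mult a (2 ^ n) P"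
  using ec_mult_add[OF assms, of "2 ^ n" "2 ^ n"] by (simp add: mult_2)

end

section \<open>Descent for quartic equations\<close>

text \<open>The odd factor is coprime to 2^j, so the whole power of two divides the other factor;
  what remains is a coprime product equal to an n-th power.\<close>

lemma coprime_prod_eq_power2k:
  fixes x y c :: nat
  assumes "coprime x y" "odd x" "x * y = 2 ^ j * c ^ n" "n > 0"
  obtains u v where "x = u ^ n" "y = 2 ^ j * v ^ n" "u * v = c" "coprime u v" "odd u"
proof -
  have "coprime (2 ^ j) x" using assms(2) by simp
  moreover have "2 ^ j dvd x * y" using assms(3) by simp
  ultimately have "2 ^ j dvd y" using coprime_dvd_mult_right_iff by blast
  then obtain z where y: "y = 2 ^ j * z" by blast
  then have xz: "x * z = c ^ n" using assms(3) by simp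
  have cxz: "coprime x z" using assms(1) y by simp
  have "is_nth_power n (x * z)" unfolding xz by simp
  then have "is_nth_power n x" "is_nth_power n z"
    using is_nth_power_mult_coprime_nat_iff[OF cxz, of n] by auto
  then obtain u v where uv: "x = u ^ n" "z = v ^ n" by (auto simp: is_nth_power_def)
  then have "(u * v) ^ n = c ^ n" using xz by (simp add: power_mult_distrib)
  then have "u * v = c" using assms(4) power_eq_iff_eq_base by blast
  moreover have "coprime u v" using cxz uv assms(4) by simp
  moreover have "odd u" using assms(2,4) uv by simp
  ultimately show thesis using that uv y by blast
qed

lemma coprime_prod_eq_power2k_sym:
  fixes x y c :: nat
  assumes "coprime x y" "odd (x + y)" "x * y = 2 ^ j * c ^ n" "n > 0"
  obtains u v where "x + y = u ^ n + 2 ^ j * v ^ n" "{x, y} = {u ^ n, 2 ^ j * v ^ n}"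
    "u * v = c" "coprime u v" "odd u"
proof (cases "odd x")
  case True
  obtain u v where "x = u ^ n" "y = 2 ^ j * v ^ n" "u * v = c" "coprime u v" "odd u"
    using coprime_prod_eq_power2k[OF assms(1) True assms(3,4)] by blast
  then show thesis using that[of u v] by simp
next
  case False
  then have "odd y" using assms(2) by simp
  moreover have "coprime y x" "y * x = 2 ^ j * c ^ n"
    using assms(1,3) by (simp_all add: coprime_commute mult.commute)
  ultimately obtain u v where "y = u ^ n" "x = 2 ^ j * v ^ n" "u * v = c" "coprime u v" "odd u"
    using coprime_prod_eq_power2k[of y x j c n] assms(4) by blast
  then show thesis using that[of u v] by (simp add: insert_commute add.commute)
qed

lemma odd_power2_mod_8: "odd (x :: nat) \<Longrightarrow> x ^ 2 mod 8 = 1"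
proof -
  assume "odd x"
  then have "x mod 8 \<in> {1, 3, 5, 7}" by (simp; presburger)
  then have "(x mod 8) ^ 2 mod 8 = 1" by auto
  then show ?thesis by (simp add: power_mod)
qed

lemma odd_power2_mod_4: "odd (x :: nat) \<Longrightarrow> x ^ 2 mod 4 = 1"
  using odd_power2_mod_8[of x] mod_mod_cancel[of 4 8 "x ^ 2"] by simp

lemma square_mod_4: "(x :: nat) ^ 2 mod 4 \<in> {0, 1}"
proof -
  have "x mod 4 \<in> {0, 1, 2, 3}" by auto
  then have "(x mod 4) ^ 2 mod 4 \<in> {0, 1}" by auto
  then show ?thesis by (simp add: power_mod)
qed

lemma coprime_mult_add: "coprime x (k * x + y) \<longleftrightarrow> coprime x y" for x y k :: nat
  by (simp add: coprime_iff_gcd_eq_1 gcd_add_mult)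

lemma coprime_add_self: "coprime x (x + y) \<longleftrightarrow> coprime x y" for x y :: nat
  using coprime_mult_add[of x 1 y] by simp

lemma odd_gap: "\<exists>k. x = y + 2 * k" if "odd x" "odd y" "y < x" for x y :: nat
  using that by presburger

lemma power4_square: "(x :: 'a :: monoid_mult) ^ 4 = (x ^ 2) ^ 2"
  by (simp flip: power_mult)

text \<open>A descent step through two factorisations. First r^2 - p^4 = 4 X (X + p^2), whose
  coprime factors are u^4 and 2^(j+2) v^4 in some order; then u^4 - p^2 = 4 Z (Z + p), whose coprime
  factors are c^4 and 2^j d^4. As Z + (Z + p) = u^2, the original shape returns with u < r.\<close>

lemma quartic_sum_not_square_aux:
  fixes p q r j :: nat
  assumes eq: "p ^ 4 + 2 ^ j * q ^ 4 = r ^ 2" and pos: "p > 0" "q > 0"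
    and cop: "coprime p q" and podd: "odd p" and qeven: "even q"
  shows "\<exists>c d u. c ^ 4 + 2 ^ j * d ^ 4 = u ^ 2 \<and> c > 0 \<and> d > 0 \<and> u < r"
proof -
  have "odd (r ^ 2)" unfolding eq[symmetric] using podd qeven by simp
  then have rodd: "odd r" by simp
  have "(p ^ 2) ^ 2 < r ^ 2" unfolding eq[symmetric] power4_square[symmetric] using pos by simp
  then have "p ^ 2 < r" by (rule power_less_imp_less_base) simp
  then obtain X where r: "r = p ^ 2 + 2 * X" using odd_gap[of r "p ^ 2"] rodd podd by auto
  obtain q' where q: "q = 2 * q'" using qeven by blast
  have "p ^ 4 + 4 * (X * (X + p ^ 2)) = r ^ 2"
    unfolding r by (simp add: algebra_simps power2_eq_square power4_eq_xxxx)
  with eq have X4: "4 * (X * (X + p ^ 2)) = 2 ^ j * q ^ 4" by simp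
  then have XY: "X * (X + p ^ 2) = 2 ^ (j + 2) * q' ^ 4"
    unfolding q by (simp add: power_mult_distrib)
  have copq: "coprime p (2 ^ i * q ^ 4)" for i using cop podd by simp
  then have "coprime p (4 * (X * (X + p ^ 2)))" unfolding X4 .
  then have copX: "coprime X (X + p ^ 2)" by (simp add: coprime_add_self coprime_commute)
  have "odd (X + (X + p ^ 2))" using podd by simp
  from coprime_prod_eq_power2k_sym[OF copX this XY zero_less_numeral] obtain u v where
    uv: "{X, X + p ^ 2} = {u ^ 4, 2 ^ (j + 2) * v ^ 4}" "u * v = q'" "coprime u v" "odd u"
    by blast
  have "u > 0" "v > 0" using uv(2) q pos by auto
  \<comment> \<open>The wrong assignment of the factors fails modulo 4: u and p are odd, so u^4 +
    p^2 is 2 modulo 4.\<close>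
  have "\<not> (X = u ^ 4 \<and> X + p ^ 2 = 2 ^ (j + 2) * v ^ 4)"
  proof
    assume *: "X = u ^ 4 \<and> X + p ^ 2 = 2 ^ (j + 2) * v ^ 4"
    have "u ^ 4 mod 4 = 1" "p ^ 2 mod 4 = 1"
      using odd_power2_mod_4[of "u ^ 2"] odd_power2_mod_4[of p] podd uv(4) by simp_all
    then have "(u ^ 4 + p ^ 2) mod 4 = 2" using mod_add_eq[of "u ^ 4" 4 "p ^ 2"] by simp
    moreover have "u ^ 4 + p ^ 2 = 4 * (2 ^ j * v ^ 4)" using * by simp
    ultimately show False by simp
  qed
  then have X: "X = 2 ^ (j + 2) * v ^ 4" "X + p ^ 2 = u ^ 4" using uv(1) by (auto simp: doubleton_eq_iff)
  have "p ^ 2 < (u ^ 2) ^ 2" unfolding power4_square[symmetric] X(2)[symmetric] X(1)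
    using \<open>v > 0\<close> by simp
  then have "p < u ^ 2" by (rule power_less_imp_less_base) simp
  then obtain Z where u2: "u ^ 2 = p + 2 * Z" using odd_gap[of "u ^ 2" p] uv(4) podd by auto
  have "p ^ 2 + 4 * (Z * (Z + p)) = u ^ 4"
    unfolding power4_square u2 by (simp add: algebra_simps power2_eq_square)
  with X have Z4: "Z * (Z + p) = 2 ^ j * v ^ 4" by simp
  have "coprime p (2 ^ j * v ^ 4)" using cop podd uv(2) q by auto
  then have copZ: "coprime Z (Z + p)" unfolding Z4[symmetric] by (simp add: coprime_add_self coprime_commute)
  have "odd (Z + (Z + p))" using podd by simp
  from coprime_prod_eq_power2k_sym[OF copZ this Z4 zero_less_numeral] obtain c d where
    cd: "Z + (Z + p) = c ^ 4 + 2 ^ j * d ^ 4" "c * d = v"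
    by blast
  have "c ^ 4 + 2 ^ j * d ^ 4 = u ^ 2" using cd(1) u2 by simp
  moreover have "c > 0" "d > 0" using cd(2) \<open>v > 0\<close> by auto
  moreover have "u < r"
  proof -
    have "X > 0" using X(1) \<open>v > 0\<close> by simp
    have "u \<le> u ^ 4" using \<open>u > 0\<close> self_le_power[of u 4] by simp
    also have "\<dots> < r" using \<open>X > 0\<close> by (simp add: r flip: X(2))
    finally show ?thesis .
  qed
  ultimately show ?thesis by blast
qed

lemma quartic_coprime_reduce:
  fixes p q :: nat
  assumes "p > 0"
  obtains g p' q' where "g > 0" "p = g * p'" "q = g * q'" "coprime p' q'" "p' > 0"
proof -
  have "gcd p q \<noteq> 0" using assms by simp
  from gcd_coprime_exists[OF this] obtain p' q' where
    "p = p' * gcd p q" "q = q' * gcd p q" "coprime p' q'" by blast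
  then show thesis using that[of "gcd p q" p' q'] assms
    by (metis gcd_pos_nat mult.commute mult_pos_pos nat_0_less_mult_iff not_gr_zero)
qed

text \<open>After division by the gcd, squares modulo 8 being 0, 1 or 4 forces the parity required
  by the descent step: p odd and q even, up to exchanging p and q when j = 0. The excluded residues
  are 2 for j = 0, and 2 or 3 for j = 1.\<close>

lemma quartic_sum_not_square:
  fixes p q r j :: nat
  assumes "p ^ 4 + 2 ^ j * q ^ 4 = r ^ 2" "p > 0" "q > 0" "j \<le> 1"
  shows False
  using assms
proof (induction r arbitrary: p q rule: less_induct)
  case (less r)
  obtain g p' q' where g: "g > 0" "p = g * p'" "q = g * q'" "coprime p' q'" "p' > 0"
    using quartic_coprime_reduce[OF less.prems(2)] by blast
  have eq: "(g ^ 2) ^ 2 * (p' ^ 4 + 2 ^ j * q' ^ 4) = r ^ 2"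
    using less.prems(1) g by (simp add: power_mult_distrib algebra_simps flip: power4_square)
  then have "g ^ 2 dvd r" by (metis dvd_triv_left pow_divides_pow_iff zero_less_numeral)
  then obtain r' where r: "r = g ^ 2 * r'" by blast
  have "(g ^ 2) ^ 2 * (p' ^ 4 + 2 ^ j * q' ^ 4) = (g ^ 2) ^ 2 * r' ^ 2"
    using eq r by (simp add: power_mult_distrib)
  then have eq': "p' ^ 4 + 2 ^ j * q' ^ 4 = r' ^ 2" using g(1) by simp
  have rr: "r' \<le> r" using r g(1) by simp
  have q': "q' > 0" using less.prems(3) g by auto
  have key: False if "odd p2" "even q2" "p2 ^ 4 + 2 ^ j * q2 ^ 4 = r' ^ 2" "coprime p2 q2" "p2 > 0" "q2 > 0"
    for p2 q2
    using quartic_sum_not_square_aux[OF that(3,5,6,4,1,2)] less.IH less.prems(4) rr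
    by (meson order_less_le_trans)
  have m1: "x ^ 4 mod 8 = 1" if "odd x" for x :: nat
    unfolding power4_square using that by (intro odd_power2_mod_8) simp
  have m0: "x ^ 4 mod 8 = 0" if "even x" for x :: nat
    using that by (auto simp: power_mult_distrib)
  have sq: "r' ^ 2 mod 8 \<in> {0, 1, 4}"
  proof -
    have "r' mod 8 \<in> {0, 1, 2, 3, 4, 5, 6, 7}" by auto
    then have "(r' mod 8) ^ 2 mod 8 \<in> {0, 1, 4}" by auto
    then show ?thesis by (simp add: power_mod)
  qed
  have both: "\<not> (even p' \<and> even q')" using g(4) coprime_common_divisor by (metis odd_one)
  consider "j = 0" | "j = 1" using less.prems(4) by linarith
  then show False
  proof cases
    case 1
    have "\<not> (odd p' \<and> odd q')"
    proof
      assume "odd p' \<and> odd q'"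
      then have "(p' ^ 4 + q' ^ 4) mod 8 = 2" using m1 mod_add_eq[of "p' ^ 4" 8 "q' ^ 4"] by simp
      with eq' sq 1 show False by simp
    qed
    then consider "odd p'" "even q'" | "odd q'" "even p'" using both by blast
    then show False
      by cases (use key[of p' q'] key[of q' p'] eq' g q' 1 in
        \<open>simp_all add: coprime_commute add.commute\<close>)
  next
    case 2
    have "odd p'"
    proof
      assume "even p'"
      then have "(p' ^ 4 + 2 * q' ^ 4) mod 8 = 2"
        using both \<open>even p'\<close> m0[of p'] m1[of q'] mod_add_eq[of "p' ^ 4" 8 "2 * q' ^ 4"]
          mod_mult_right_eq[of 2 "q' ^ 4" 8] by simp
      then have "r' ^ 2 mod 8 = 2" using eq' 2 by simp
      with sq show False by simp
    qed
    moreover have "even q'"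
    proof (rule ccontr)
      assume "odd q'"
      then have "(p' ^ 4 + 2 * q' ^ 4) mod 8 = 3"
        using \<open>odd p'\<close> m1[of p'] m1[of q'] mod_add_eq[of "p' ^ 4" 8 "2 * q' ^ 4"]
          mod_mult_right_eq[of 2 "q' ^ 4" 8] by simp
      then have "r' ^ 2 mod 8 = 3" using eq' 2 by simp
      with sq show False by simp
    qed
    ultimately show False using key[of p' q'] eq' g q' by simp
  qed
qed

text \<open>The half sum and half difference of p^2 and q^2 are coprime with square product, hence
  squares c^2 and d^2. Then p^2 = c^2 + d^2 and q^2 = c^2 - d^2 multiply to (p q)^2 = c^4 -
  d^4.\<close>

lemma quartic_diff_not_square_odd:
  fixes p q r :: nat
  assumes eq: "p ^ 4 = q ^ 4 + r ^ 2" and pos: "q > 0" "r > 0" and cop: "coprime p q"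
    and odd: "odd p" "odd q"
  shows "\<exists>c d s. c ^ 4 = d ^ 4 + s ^ 2 \<and> d > 0 \<and> s > 0 \<and> c < p"
proof -
  have "(q ^ 2) ^ 2 < (p ^ 2) ^ 2" using eq pos by (simp flip: power4_square)
  then have "q ^ 2 < p ^ 2" by (rule power_less_imp_less_base) simp
  then obtain X where p2: "p ^ 2 = q ^ 2 + 2 * X" using odd_gap[of "p ^ 2" "q ^ 2"] odd by auto
  have "(p ^ 2) ^ 2 = (q ^ 2) ^ 2 + 4 * (X * (X + q ^ 2))"
    unfolding p2 by (simp add: algebra_simps power2_eq_square)
  then have r2: "4 * (X * (X + q ^ 2)) = r ^ 2" using eq by (simp flip: power4_square)
  then have "even (r ^ 2)" by (metis dvd_mult2 even_numeral)
  then obtain r' where r: "r = 2 * r'" by auto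
  then have X: "X * (X + q ^ 2) = r' ^ 2" using r2 by (simp add: power_mult_distrib)
  have "coprime q (p ^ 2)" using cop by (simp add: coprime_commute)
  then have "coprime q (q * q + 2 * X)" unfolding p2 by (simp only: power2_eq_square)
  then have "coprime q (2 * X)" by (simp only: coprime_mult_add)
  then have "coprime X (X + q ^ 2)" by (simp add: coprime_add_self coprime_commute)
  then have "is_square X" "is_square (X + q ^ 2)"
    using is_nth_power_mult_coprime_nat_iff[of X "X + q ^ 2" 2] X by auto
  then obtain d c where dc: "X = d ^ 2" "X + q ^ 2 = c ^ 2" by (auto simp: is_nth_power_def)
  have "X > 0" using X r pos by (cases X) auto
  then have "d > 0" using dc by simp
  have c2: "p ^ 2 = c ^ 2 + d ^ 2" "c ^ 2 = q ^ 2 + d ^ 2" using p2 dc by auto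
  have "c ^ 4 = d ^ 4 + (p * q) ^ 2"
    unfolding power4_square power_mult_distrib c2(1) unfolding c2(2)
    by (simp add: algebra_simps power2_eq_square)
  moreover have "c ^ 2 < p ^ 2" using c2(1) \<open>d > 0\<close> by simp
  then have "c < p" by (rule power_less_imp_less_base) simp
  moreover have "p * q > 0" using odd by (simp add: odd_pos)
  ultimately show ?thesis using \<open>d > 0\<close> by blast
qed

text \<open>Here p^2 - q^2 = d^2 and p^2 + q^2 = c^2 are already coprime squares. With n = (c -
  d)/2, the numbers n and n + d are the legs of a right triangle with hypotenuse p, and they equal
  e^2 and 2 f^2 in some order. Factoring p^2 - e^4 = 4 f^4 once more yields fourth powers g^4 and
  h^4 with difference e^2.\<close>

lemma quartic_diff_not_square_even:
  fixes p q r :: nat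
  assumes eq: "p ^ 4 = q ^ 4 + r ^ 2" and pos: "q > 0" "r > 0" and cop: "coprime p q"
    and par: "odd p" "even q"
  shows "\<exists>c d s. c ^ 4 = d ^ 4 + s ^ 2 \<and> d > 0 \<and> s > 0 \<and> c < p"
proof -
  have "(q ^ 2) ^ 2 < (p ^ 2) ^ 2" using eq pos by (simp flip: power4_square)
  then have "q ^ 2 < p ^ 2" by (rule power_less_imp_less_base) simp
  then obtain X where p2: "p ^ 2 = q ^ 2 + X" by (metis le_add_diff_inverse less_imp_le)
  have "(p ^ 2) ^ 2 = (q ^ 2) ^ 2 + X * (X + 2 * q ^ 2)"
    unfolding p2 by (simp add: algebra_simps power2_eq_square)
  then have X: "X * (X + 2 * q ^ 2) = r ^ 2" using eq by (simp flip: power4_square)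
  have "odd (q ^ 2 + X)" unfolding p2[symmetric] using par by simp
  then have oddX: "odd X" using par by simp
  have "coprime q (p ^ 2)" using cop by (simp add: coprime_commute)
  then have "coprime q (q * q + X)" unfolding p2 by (simp only: power2_eq_square)
  then have "coprime q X" by (simp only: coprime_mult_add)
  then have "coprime X (X + 2 * q ^ 2)" using oddX by (simp add: coprime_add_self coprime_commute)
  then have "is_square X" "is_square (X + 2 * q ^ 2)"
    using is_nth_power_mult_coprime_nat_iff[of X "X + 2 * q ^ 2" 2] X by auto
  then obtain d c where dc: "X = d ^ 2" "X + 2 * q ^ 2 = c ^ 2" by (auto simp: is_nth_power_def)
  have "odd (d ^ 2)" "odd (c ^ 2)" using dc oddX by (metis, simp flip: dc(2))
  then have "odd d" "odd c" by auto
  have "d ^ 2 < c ^ 2" unfolding dc(2)[symmetric] dc(1) using pos by simp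
  then have "d < c" by (rule power_less_imp_less_base) simp
  then obtain n where c: "c = d + 2 * n" using odd_gap[of c d] \<open>odd d\<close> \<open>odd c\<close> by auto
  obtain q' where q: "q = 2 * q'" using par by blast
  have "4 * (n * (n + d)) = 2 * q ^ 2" using dc unfolding c
    by (simp add: algebra_simps power2_eq_square)
  then have nm: "n * (n + d) = 2 ^ 1 * q' ^ 2" unfolding q by (simp add: power_mult_distrib)
  have "coprime d q" using \<open>coprime q X\<close> dc by (simp add: coprime_commute)
  then have "coprime d (n * (n + d))" unfolding nm q using \<open>odd d\<close> by simp
  then have "coprime n (n + d)" by (simp add: coprime_add_self coprime_commute)
  moreover have "odd (n + (n + d))" using \<open>odd d\<close> by simp
  ultimately obtain e f where ef: "{n, n + d} = {e ^ 2, 2 ^ 1 * f ^ 2}" "e * f = q'" "coprime e f" "odd e"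
    using coprime_prod_eq_power2k_sym[OF _ _ nm zero_less_numeral] by blast
  have ef0: "e > 0" "f > 0" using ef(2) q pos by auto
  have "n ^ 2 + (n + d) ^ 2 = q ^ 2 + d ^ 2"
    using \<open>4 * (n * (n + d)) = 2 * q ^ 2\<close> by (simp add: algebra_simps power2_eq_square)
  then have "n ^ 2 + (n + d) ^ 2 = p ^ 2" using p2 dc by simp
  moreover have "n ^ 2 + (n + d) ^ 2 = e ^ 4 + 4 * f ^ 4"
  proof -
    have "n = e ^ 2 \<and> n + d = 2 * f ^ 2 \<or> n = 2 * f ^ 2 \<and> n + d = e ^ 2"
      using ef(1) by (simp add: doubleton_eq_iff)
    moreover have "x ^ 2 + y ^ 2 = e ^ 4 + 4 * f ^ 4" if "x = e ^ 2" "y = 2 * f ^ 2" for x y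
      unfolding that by (simp add: power_mult_distrib)
    ultimately show ?thesis by (metis add.commute)
  qed
  ultimately have p: "e ^ 4 + 4 * f ^ 4 = p ^ 2" by simp
  have "(e ^ 2) ^ 2 < p ^ 2" unfolding p[symmetric] power4_square[symmetric] using ef0 by simp
  then have "e ^ 2 < p" by (rule power_less_imp_less_base) simp
  then obtain Z where Z: "p = e ^ 2 + 2 * Z" using odd_gap[of p "e ^ 2"] par ef(4) by auto
  have "e ^ 4 + 4 * (Z * (Z + e ^ 2)) = p ^ 2"
    unfolding Z power4_square by (simp add: algebra_simps power2_eq_square)
  then have ZZ: "Z * (Z + e ^ 2) = f ^ 4" using p by simp
  have "coprime e (Z * (Z + e ^ 2))" unfolding ZZ using ef(3) by simp
  then have "coprime Z (Z + e ^ 2)" by (simp add: coprime_add_self coprime_commute)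
  then have "is_nth_power 4 Z" "is_nth_power 4 (Z + e ^ 2)"
    using is_nth_power_mult_coprime_nat_iff[of Z "Z + e ^ 2" 4] ZZ by auto
  then obtain h g where hg: "Z = h ^ 4" "Z + e ^ 2 = g ^ 4" by (auto simp: is_nth_power_def)
  have "Z > 0" using ZZ ef0 by (cases Z) auto
  have "g ^ 4 = h ^ 4 + e ^ 2" using hg by simp
  moreover have "h > 0" using \<open>Z > 0\<close> hg by (cases h) auto
  moreover have "g < p"
  proof -
    have "g > 0" using hg ef0 by (cases g) auto
    then have "g \<le> g ^ 4" using self_le_power[of g 4] by simp
    also have "\<dots> < p" using \<open>Z > 0\<close> by (simp add: Z flip: hg(2))
    finally show ?thesis .
  qed
  ultimately show ?thesis using ef0 by blast
qed

text \<open>For a coprime pair p must be odd, since -1 is not a square modulo 4; the parity of q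
  then selects the descent step.\<close>

lemma quartic_diff_not_square:
  fixes p q r :: nat
  assumes "p ^ 4 = q ^ 4 + r ^ 2" "q > 0" "r > 0"
  shows False
  using assms
proof (induction p arbitrary: q r rule: less_induct)
  case (less p)
  have "p > 0" using less.prems by (cases p) auto
  then obtain g p' q' where g: "g > 0" "p = g * p'" "q = g * q'" "coprime p' q'" "p' > 0"
    using quartic_coprime_reduce by blast
  have eq: "(g ^ 2) ^ 2 * p' ^ 4 = (g ^ 2) ^ 2 * q' ^ 4 + r ^ 2"
    using less.prems(1) g by (simp add: power_mult_distrib flip: power4_square)
  then have "(g ^ 2) ^ 2 dvd r ^ 2" by (metis dvd_add_right_iff dvd_triv_left)
  then have "g ^ 2 dvd r" by (metis pow_divides_pow_iff zero_less_numeral)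
  then obtain r' where r: "r = g ^ 2 * r'" by blast
  have "(g ^ 2) ^ 2 * p' ^ 4 = (g ^ 2) ^ 2 * (q' ^ 4 + r' ^ 2)"
    using eq r by (simp add: power_mult_distrib algebra_simps)
  then have eq': "p' ^ 4 = q' ^ 4 + r' ^ 2" using g(1) by simp
  have pos: "q' > 0" "r' > 0" using less.prems g r by auto
  have le: "p' \<le> p" using g by simp
  have "odd p'"
  proof
    assume ev: "even p'"
    then have "odd q'" using g(4) coprime_common_divisor by (metis odd_one)
    then have "(q' ^ 2) ^ 2 mod 8 = 1" by (intro odd_power2_mod_8) simp
    moreover have "(p' ^ 2) ^ 2 mod 8 = 0" using ev by (auto simp: power_mult_distrib)
    ultimately have "r' ^ 2 mod 8 = 7"
      using eq' unfolding power4_square by presburger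
    then have "r' ^ 2 mod 4 = 3" using mod_mod_cancel[of 4 8 "r' ^ 2"] by simp
    then show False using square_mod_4[of r'] by simp
  qed
  then have "\<exists>c d s. c ^ 4 = d ^ 4 + s ^ 2 \<and> d > 0 \<and> s > 0 \<and> c < p'"
    using quartic_diff_not_square_odd[OF eq' pos g(4)] quartic_diff_not_square_even[OF eq' pos g(4)]
    by blast
  then show False using less.IH le by (meson order_less_le_trans)
qed

section \<open>Growth under duplication\<close>

text \<open>For x = |s| and u = sqrt|a| |t| the left sides are the value of \<open>G\<close> at the
  doubled point before common factors are cancelled, for a > 0 and a < 0 respectively.\<close>

lemma abs_add_sqrt_dup_le:
  fixes x u :: real
  assumes "x \<ge> 0" "u \<ge> 0"
  shows "(x ^ 2 - u ^ 2) ^ 2 + 4 * x * u * (x ^ 2 + u ^ 2) \<le> (x + u) ^ 4"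
    "(x ^ 2 + u ^ 2) ^ 2 + 4 * x * u * \<bar>x ^ 2 - u ^ 2\<bar> \<le> (x + u) ^ 4"
proof -
  have "(x + u) ^ 4 - ((x ^ 2 - u ^ 2) ^ 2 + 4 * x * u * (x ^ 2 + u ^ 2)) = 8 * (x * u) ^ 2"
    by (simp add: power2_eq_square power4_eq_xxxx algebra_simps)
  then show "(x ^ 2 - u ^ 2) ^ 2 + 4 * x * u * (x ^ 2 + u ^ 2) \<le> (x + u) ^ 4"
    using zero_le_power2[of "x * u"] by linarith
  have "(x ^ 2 + u ^ 2) ^ 2 + 4 * x * u * \<bar>x ^ 2 - u ^ 2\<bar> \<le> (x ^ 2 + u ^ 2) ^ 2 + 4 * x * u * (x ^ 2 + u ^ 2)"
    using assms by (intro add_left_mono mult_left_mono) (auto simp: abs_le_iff)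
  also have "(x + u) ^ 4 - \<dots> = 4 * (x * u) ^ 2"
    by (simp add: power2_eq_square power4_eq_xxxx algebra_simps)
  then have "(x ^ 2 + u ^ 2) ^ 2 + 4 * x * u * (x ^ 2 + u ^ 2) \<le> (x + u) ^ 4"
    using zero_le_power2[of "x * u"] by linarith
  finally show "(x ^ 2 + u ^ 2) ^ 2 + 4 * x * u * \<bar>x ^ 2 - u ^ 2\<bar> \<le> (x + u) ^ 4" .
qed

text \<open>Writing \<open>x + i u = r e\<^sup>i\<^sup>\<theta>\<close>, the second square on the left is \<open>r\<^sup>8 sin\<^sup>2 4\<theta>\<close>.\<close>

lemma dup_norm_le:
  fixes x u :: real
  shows "((x ^ 2 + u ^ 2) ^ 2) ^ 2 + (4 * x * u * (x ^ 2 - u ^ 2)) ^ 2 \<le> 2 * (x ^ 2 + u ^ 2) ^ 4"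
proof -
  have "2 * (x ^ 2 + u ^ 2) ^ 4 - (((x ^ 2 + u ^ 2) ^ 2) ^ 2 + (4 * x * u * (x ^ 2 - u ^ 2)) ^ 2)
      = ((x ^ 2 - u ^ 2) ^ 2 - (2 * x * u) ^ 2) ^ 2"
    by algebra
  then show ?thesis using zero_le_power2[of "(x ^ 2 - u ^ 2) ^ 2 - (2 * x * u) ^ 2"] by linarith
qed

text \<open>As b - c is coprime to b and c and shares at most a factor 2 with b + c, only powers of
  two can cancel. If b and c are odd, put b - c = 2 m and b + c = 2 n; m and n have opposite parity,
  and the pair 16 m^4, 64 b c n^2 has common factor 64 or 16 according as m is even or odd. The
  quotients have odd sum, which prevents cancellation in all later steps.\<close>

lemma coprime_dup:
  fixes b c :: int
  assumes cop: "coprime b c"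
  shows "\<exists>e b' c'. (b - c) ^ 4 = e * b' \<and> 16 * b * c * (b + c) ^ 2 = e * c' \<and> coprime b' c' \<and>
    odd (b' + c') \<and> 1 \<le> e \<and> e \<le> 64 \<and> (odd (b + c) \<longrightarrow> e = 1)"
proof (cases "odd (b + c)")
  case True
  have c1: "coprime (b - c) b" "coprime (b - c) c"
    using cop by (metis coprime_iff_gcd_eq_1 gcd.commute gcd_diff1 gcd_diff2)+
  have "coprime (b - c) 2" using True by simp
  then have "coprime (b - c) (2 * c)" using c1 by simp
  then have "coprime (b - c) ((b - c) + 2 * c)" by (simp only: coprime_iff_gcd_eq_1 gcd_add2)
  then have "coprime (b - c) (b + c)" by (simp add: add.commute)
  moreover have "coprime (b - c) 16"
    using True coprime_power_right_iff[of "b - c" 2 4] by simp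
  ultimately have "coprime ((b - c) ^ 4) (16 * b * c * (b + c) ^ 2)" using c1 by simp
  moreover have "odd ((b - c) ^ 4 + 16 * b * c * (b + c) ^ 2)" using True by simp
  ultimately show ?thesis using True
    by (intro exI[of _ 1] exI[of _ "(b - c) ^ 4"] exI[of _ "16 * b * c * (b + c) ^ 2"]) simp
next
  case False
  then have "even (b - c)" by simp
  then obtain m where m: "b - c = 2 * m" by blast
  define n where "n = m + c"
  have bc: "b = n + m" "c = n - m" using m n_def by auto
  have oddb: "odd b" "odd c" using False cop coprime_common_divisor[of b c 2] by auto
  have mn: "coprime m n"
  proof (rule coprimeI)
    fix x assume "x dvd m" "x dvd n"
    then have "x dvd b" "x dvd c" using bc by auto
    then show "x dvd 1" using cop coprime_common_divisor by blast
  qed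
  have "coprime m (m + c)" using mn unfolding n_def .
  then have "coprime m c" by (simp only: coprime_iff_gcd_eq_1 gcd_add2)
  moreover have "coprime m (m + n)" using mn by (simp only: coprime_iff_gcd_eq_1 gcd_add2)
  then have "coprime m b" unfolding bc by (simp only: add.commute)
  ultimately have cm: "coprime m (b * c * n ^ 2)" using mn by simp
  have B: "(b - c) ^ 4 = 16 * m ^ 4" unfolding m by (simp add: power_mult_distrib)
  have C: "16 * b * c * (b + c) ^ 2 = 64 * (b * c * n ^ 2)"
    unfolding bc by algebra
  show ?thesis
  proof (cases "even m")
    case True
    then obtain l where l: "m = 2 * l" by blast
    have "odd n" using True oddb bc by simp
    then have "odd (b * c * n ^ 2)" using oddb by simp
    moreover from this have "coprime 4 (b * c * n ^ 2)"
      using coprime_power_left_iff[of 2 2 "b * c * n ^ 2"] by simp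
    moreover have "coprime l (b * c * n ^ 2)" using cm l by simp
    ultimately have "coprime (4 * l ^ 4) (b * c * n ^ 2) \<and> odd (4 * l ^ 4 + b * c * n ^ 2)"
      by simp
    then show ?thesis using False B C l
      by (intro exI[of _ 64] exI[of _ "4 * l ^ 4"] exI[of _ "b * c * n ^ 2"])
        (auto simp: power_mult_distrib)
  next
    case odd: False
    have "coprime m 4" using odd coprime_power_right_iff[of m 2 2] by simp
    then have "coprime (m ^ 4) (4 * (b * c * n ^ 2))" using cm by simp
    moreover have "odd (m ^ 4 + 4 * (b * c * n ^ 2))" using odd by simp
    ultimately show ?thesis using False B C
      by (intro exI[of _ 16] exI[of _ "m ^ 4"] exI[of _ "4 * (b * c * n ^ 2)"]) auto
  qed
qed

text \<open>For opposite signs |b - c| equals |b| + |c|, and the first term suffices. For equal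
  signs the second term more than makes up for the smaller first one.\<close>

lemma abs_sum_dup_ge:
  fixes b c :: int
  shows "(\<bar>b\<bar> + \<bar>c\<bar>) ^ 4 \<le> \<bar>(b - c) ^ 4\<bar> + \<bar>16 * b * c * (b + c) ^ 2\<bar>"
proof -
  define x y where "x = \<bar>b\<bar>" and "y = \<bar>c\<bar>"
  have nn: "x \<ge> 0" "y \<ge> 0" by (auto simp: x_def y_def)
  have p: "(x - y) ^ 4 + 16 * x * y * (x + y) ^ 2 - (x + y) ^ 4 = 8 * (x * y) * (x ^ 2 + y ^ 2) + 32 * (x * y) ^ 2"
    by algebra
  have q: "(x + y) ^ 4 + 16 * x * y * (x - y) ^ 2 \<ge> (x + y) ^ 4" using nn by simp
  have "8 * (x * y) * (x ^ 2 + y ^ 2) + 32 * (x * y) ^ 2 \<ge> 0" using nn by simp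
  with p have p': "(x - y) ^ 4 + 16 * x * y * (x + y) ^ 2 \<ge> (x + y) ^ 4" by linarith
  consider "b = x" "c = y" | "b = x" "c = - y" | "b = - x" "c = y" | "b = - x" "c = - y"
    unfolding x_def y_def by linarith
  then show ?thesis
  proof cases
    case 1
    then show ?thesis using p' nn by (simp add: abs_mult)
  next
    case 2
    then show ?thesis using q nn by (simp add: abs_mult)
  next
    case 3
    have "(- x - y) ^ 4 = (x + y) ^ 4" "(y - x) ^ 2 = (x - y) ^ 2" by algebra+
    then show ?thesis using q nn 3 by (simp add: abs_mult)
  next
    case 4
    have "(- x + y) ^ 4 = (x - y) ^ 4" "(- x - y) ^ 2 = (x + y) ^ 2" by algebra+
    then show ?thesis using p' nn 4 by (simp add: abs_mult)
  qed
qed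

text \<open>Lowest-terms coordinates \<open>s n / t n\<close> of the abscissae of the points \<open>2\<^sup>n P\<close>, the point at
  infinity being \<open>1 / 0\<close>.\<close>

locale dup_seq =
  fixes a :: int and s t :: "nat \<Rightarrow> int"
  assumes a0: "a \<noteq> 0"
    and cop: "coprime (s n) (t n)"
    and step: "\<exists>d\<ge>1. (s n ^ 2 - a * t n ^ 2) ^ 2 = d * s (Suc n) \<and>
      4 * s n * t n * (s n ^ 2 + a * t n ^ 2) = d * t (Suc n)"
begin

definition m :: "nat \<Rightarrow> real" where "m n = real_of_int (max \<bar>s n\<bar> \<bar>t n\<bar>)"
definition A :: real where "A = \<bar>real_of_int a\<bar>"
definition G :: "nat \<Rightarrow> real" where "G n = \<bar>real_of_int (s n)\<bar> + sqrt A * \<bar>real_of_int (t n)\<bar>"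
definition N :: "nat \<Rightarrow> real" where "N n = real_of_int (s n) ^ 2 + A * real_of_int (t n) ^ 2"
definition L :: real where "L = lim (\<lambda>n. ln (m n) / 4 ^ n)"

lemma A_ge_1: "A \<ge> 1"
  using a0 unfolding A_def by linarith

lemma nonzero: "s n \<noteq> 0 \<or> t n \<noteq> 0"
  using cop[of n] by auto

lemma m_ge_1: "m n \<ge> 1"
  using nonzero[of n] unfolding m_def by linarith

lemma m_ge: "\<bar>real_of_int (s n)\<bar> \<le> m n" "\<bar>real_of_int (t n)\<bar> \<le> m n"
  unfolding m_def by auto

lemma m_cases: "m n = \<bar>real_of_int (s n)\<bar> \<or> m n = \<bar>real_of_int (t n)\<bar>"
  unfolding m_def by (auto simp: max_def)

lemma m_le_G: "m n \<le> G n"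
proof -
  have "1 * \<bar>real_of_int (t n)\<bar> \<le> sqrt A * \<bar>real_of_int (t n)\<bar>"
    using A_ge_1 by (intro mult_right_mono) auto
  then show ?thesis using m_cases[of n] A_ge_1 unfolding G_def by auto
qed

lemma G_le_m: "G n \<le> (1 + sqrt A) * m n"
proof -
  have "sqrt A * \<bar>real_of_int (t n)\<bar> \<le> sqrt A * m n"
    using A_ge_1 m_ge by (intro mult_left_mono) auto
  then show ?thesis using m_ge(1)[of n] unfolding G_def by (simp add: algebra_simps)
qed

lemma m_le_N: "m n ^ 2 \<le> N n"
proof -
  have "1 * real_of_int (t n) ^ 2 \<le> A * real_of_int (t n) ^ 2"
    using A_ge_1 by (intro mult_right_mono) auto
  moreover have "0 \<le> real_of_int (s n) ^ 2" "0 \<le> real_of_int (t n) ^ 2" by simp_all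
  moreover have "m n ^ 2 = real_of_int (s n) ^ 2 \<or> m n ^ 2 = real_of_int (t n) ^ 2"
    using m_cases[of n] by (metis power2_abs)
  ultimately show ?thesis unfolding N_def by linarith
qed

lemma N_le_m: "N n \<le> (1 + A) * m n ^ 2"
proof -
  have "real_of_int (s n) ^ 2 \<le> m n ^ 2" "real_of_int (t n) ^ 2 \<le> m n ^ 2"
    using m_ge[of n] by (metis abs_ge_zero power2_abs power_mono)+
  moreover from this(2) have "A * real_of_int (t n) ^ 2 \<le> A * m n ^ 2"
    using A_ge_1 by (intro mult_left_mono) auto
  ultimately show ?thesis unfolding N_def by (simp add: algebra_simps)
qed

lemma step_le:
  "\<bar>real_of_int (s (Suc n))\<bar> \<le> (real_of_int (s n) ^ 2 - a * real_of_int (t n) ^ 2) ^ 2"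
  "\<bar>real_of_int (t (Suc n))\<bar> \<le>
    4 * \<bar>real_of_int (s n)\<bar> * \<bar>real_of_int (t n)\<bar> * \<bar>real_of_int (s n) ^ 2 + a * real_of_int (t n) ^ 2\<bar>"
proof -
  from step[of n] obtain d where d: "d \<ge> 1" "(s n ^ 2 - a * t n ^ 2) ^ 2 = d * s (Suc n)"
    "4 * s n * t n * (s n ^ 2 + a * t n ^ 2) = d * t (Suc n)" by blast
  have le: "\<bar>x\<bar> \<le> \<bar>d * x\<bar>" for x
    using d(1) mult_right_mono[of 1 d "\<bar>x\<bar>"] by (simp add: abs_mult)
  have "\<bar>s (Suc n)\<bar> \<le> (s n ^ 2 - a * t n ^ 2) ^ 2"
    using le[of "s (Suc n)"] unfolding d(2)[symmetric] by simp
  then show "\<bar>real_of_int (s (Suc n))\<bar> \<le> (real_of_int (s n) ^ 2 - a * real_of_int (t n) ^ 2) ^ 2"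
    by (metis (mono_tags) of_int_abs of_int_diff of_int_le_iff of_int_mult of_int_power)
  have "\<bar>t (Suc n)\<bar> \<le> 4 * \<bar>s n\<bar> * \<bar>t n\<bar> * \<bar>s n ^ 2 + a * t n ^ 2\<bar>"
    using le[of "t (Suc n)"] unfolding d(3)[symmetric] by (simp add: abs_mult)
  then have "real_of_int \<bar>t (Suc n)\<bar> \<le> real_of_int (4 * \<bar>s n\<bar> * \<bar>t n\<bar> * \<bar>s n ^ 2 + a * t n ^ 2\<bar>)"
    by (simp only: of_int_le_iff)
  then show "\<bar>real_of_int (t (Suc n))\<bar> \<le>
    4 * \<bar>real_of_int (s n)\<bar> * \<bar>real_of_int (t n)\<bar> * \<bar>real_of_int (s n) ^ 2 + a * real_of_int (t n) ^ 2\<bar>"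
    by simp
qed

text \<open>The bounds stay in polynomial form because the case a >= 3 of the uniform lower bound
  needs more than the estimate by \<open>G n ^ 4\<close>.\<close>

lemma G_Suc_le_poly:
  defines "x n \<equiv> \<bar>real_of_int (s n)\<bar>" and "u n \<equiv> sqrt A * \<bar>real_of_int (t n)\<bar>"
  shows "a > 0 \<Longrightarrow> G (Suc n) \<le> (x n ^ 2 - u n ^ 2) ^ 2 + 4 * x n * u n * (x n ^ 2 + u n ^ 2)"
    and "a < 0 \<Longrightarrow> G (Suc n) \<le> (x n ^ 2 + u n ^ 2) ^ 2 + 4 * x n * u n * \<bar>x n ^ 2 - u n ^ 2\<bar>"
    and "a < 0 \<Longrightarrow> N (Suc n) \<le> ((x n ^ 2 + u n ^ 2) ^ 2) ^ 2 + (4 * x n * u n * (x n ^ 2 - u n ^ 2)) ^ 2"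
proof -
  have u2: "u n ^ 2 = A * real_of_int (t n) ^ 2" and x2: "x n ^ 2 = real_of_int (s n) ^ 2"
    using A_ge_1 by (simp_all add: u_def x_def power_mult_distrib)
  have tt: "sqrt A * \<bar>real_of_int (t (Suc n))\<bar> \<le> sqrt A * (4 * \<bar>real_of_int (s n)\<bar> * \<bar>real_of_int (t n)\<bar> * \<bar>real_of_int (s n) ^ 2 + a * real_of_int (t n) ^ 2\<bar>)"
    using step_le(2) A_ge_1 by (intro mult_left_mono) auto
  have tt': "sqrt A * \<bar>real_of_int (t (Suc n))\<bar> \<le> 4 * x n * u n * \<bar>real_of_int (s n) ^ 2 + a * real_of_int (t n) ^ 2\<bar>"
    using tt unfolding x_def u_def by (simp only: mult_ac)
  show "G (Suc n) \<le> (x n ^ 2 - u n ^ 2) ^ 2 + 4 * x n * u n * (x n ^ 2 + u n ^ 2)" if "a > 0"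
  proof -
    have "a * real_of_int (t n) ^ 2 = u n ^ 2" using that by (simp add: u2 A_def)
    moreover have "\<bar>x n ^ 2 + u n ^ 2\<bar> = x n ^ 2 + u n ^ 2" by (simp add: abs_of_nonneg)
    ultimately show ?thesis
      using step_le(1)[of n] tt' unfolding G_def x2[symmetric] by simp
  qed
  have neg: "a * real_of_int (t n) ^ 2 = - (u n ^ 2)" if "a < 0"
    using that by (simp add: u2 A_def)
  show "G (Suc n) \<le> (x n ^ 2 + u n ^ 2) ^ 2 + 4 * x n * u n * \<bar>x n ^ 2 - u n ^ 2\<bar>" if "a < 0"
    using step_le(1)[of n] tt' neg[OF that] unfolding G_def x2[symmetric] by simp
  show "N (Suc n) \<le> ((x n ^ 2 + u n ^ 2) ^ 2) ^ 2 + (4 * x n * u n * (x n ^ 2 - u n ^ 2)) ^ 2" if "a < 0"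
  proof -
    have "\<bar>real_of_int (s (Suc n))\<bar> \<le> (x n ^ 2 + u n ^ 2) ^ 2"
      using step_le(1)[of n] neg[OF that] unfolding x2[symmetric] by simp
    then have "\<bar>real_of_int (s (Suc n))\<bar> ^ 2 \<le> ((x n ^ 2 + u n ^ 2) ^ 2) ^ 2"
      by (intro power_mono) auto
    moreover have "sqrt A * \<bar>real_of_int (t (Suc n))\<bar> \<le> 4 * x n * u n * \<bar>x n ^ 2 - u n ^ 2\<bar>"
      using tt' neg[OF that] unfolding x2[symmetric] by simp
    then have "(sqrt A * \<bar>real_of_int (t (Suc n))\<bar>) ^ 2 \<le> (4 * x n * u n * \<bar>x n ^ 2 - u n ^ 2\<bar>) ^ 2"
      using A_ge_1 by (intro power_mono) auto
    then have "A * real_of_int (t (Suc n)) ^ 2 \<le> (4 * x n * u n * (x n ^ 2 - u n ^ 2)) ^ 2"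
      using A_ge_1 by (simp add: power_mult_distrib)
    ultimately show ?thesis unfolding N_def by simp
  qed
qed

lemma G_Suc_le: "G (Suc n) \<le> G n ^ 4"
proof -
  have "\<bar>real_of_int (s n)\<bar> \<ge> 0" "sqrt A * \<bar>real_of_int (t n)\<bar> \<ge> 0" using A_ge_1 by auto
  from abs_add_sqrt_dup_le[OF this] show ?thesis
    using G_Suc_le_poly(1,2)[of n] a0 unfolding G_def[of n]
    by (cases "a > 0") (force intro: order_trans)+
qed

lemma N_Suc_le:
  assumes "a < 0"
  shows "N (Suc n) \<le> 2 * N n ^ 4"
proof -
  have "(sqrt A * \<bar>real_of_int (t n)\<bar>) ^ 2 = A * real_of_int (t n) ^ 2"
    using A_ge_1 by (simp add: power_mult_distrib)
  then show ?thesis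
    using order_trans[OF G_Suc_le_poly(3)[OF assms] dup_norm_le, of n] unfolding N_def[of n] by simp
qed

lemma G_ge_1: "G n \<ge> 1" and N_ge_1: "N n \<ge> 1"
proof -
  show "G n \<ge> 1" using m_ge_1 m_le_G order_trans by blast
  have "1 \<le> m n ^ 2" using m_ge_1 by simp
  then show "N n \<ge> 1" using m_le_N order_trans by blast
qed

section \<open>Passage to the limit\<close>

lemma ln_G_tendsto: "convergent (\<lambda>n. ln (G n) / 4 ^ n)" "decseq (\<lambda>n. ln (G n) / 4 ^ n)"
proof -
  show dec: "decseq (\<lambda>n. ln (G n) / 4 ^ n)"
  proof (rule decseq_SucI)
    fix n
    have "ln (G (Suc n)) \<le> ln (G n ^ 4)"
      using G_Suc_le[of n] G_ge_1[of "Suc n"] by (subst ln_le_cancel_iff) auto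
    also have "\<dots> = 4 * ln (G n)" using G_ge_1[of n] by (simp add: ln_realpow)
    finally show "ln (G (Suc n)) / 4 ^ Suc n \<le> ln (G n) / 4 ^ n" by (simp add: field_simps)
  qed
  have nn: "0 \<le> ln (G n) / 4 ^ n" for n using G_ge_1[of n] by simp
  have "norm (ln (G n) / 4 ^ n) \<le> ln (G 0)" for n
    unfolding real_norm_def abs_of_nonneg[OF nn] using decseqD[OF dec, of 0 n] by simp
  then have "Bseq (\<lambda>n. ln (G n) / 4 ^ n)" by (rule BseqI')
  then show "convergent (\<lambda>n. ln (G n) / 4 ^ n)"
    using dec Bseq_monoseq_convergent decseq_imp_monoseq by blast
qed

lemma ln_m_bounds: "ln (m n) \<le> ln (G n)" "ln (G n) \<le> ln (1 + sqrt A) + ln (m n)"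
proof -
  show "ln (m n) \<le> ln (G n)"
    using m_le_G[of n] m_ge_1[of n] G_ge_1[of n] by (subst ln_le_cancel_iff) auto
  have "ln (G n) \<le> ln ((1 + sqrt A) * m n)"
    using G_le_m[of n] m_ge_1[of n] G_ge_1[of n] A_ge_1
    by (subst ln_le_cancel_iff) (auto intro!: mult_pos_pos add_pos_nonneg)
  also have "\<dots> = ln (1 + sqrt A) + ln (m n)"
    using m_ge_1[of n] A_ge_1 by (intro ln_mult_pos) (auto intro!: add_pos_nonneg)
  finally show "ln (G n) \<le> ln (1 + sqrt A) + ln (m n)" .
qed

lemma const_div_4_tendsto: "(\<lambda>n. (c :: real) / 4 ^ n) \<longlonglongrightarrow> 0"
  using tendsto_mult_right[OF LIMSEQ_power_zero[of "1 / 4 :: real"], of c] by (simp add: power_divide)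

text \<open>The \<open>lim\<close> in \<open>L\<close> means something only once convergence is
  known. It is inherited from the monotone sequence for \<open>G\<close>, since ln m and ln G differ
  by a bounded amount.\<close>

lemma tendsto_L: "(\<lambda>n. ln (m n) / 4 ^ n) \<longlonglongrightarrow> L" "(\<lambda>n. ln (G n) / 4 ^ n) \<longlonglongrightarrow> L"
proof -
  obtain l where l: "(\<lambda>n. ln (G n) / 4 ^ n) \<longlonglongrightarrow> l"
    using ln_G_tendsto(1) by (auto simp: convergent_def)
  have low: "(\<lambda>n. ln (G n) / 4 ^ n - ln (1 + sqrt A) / 4 ^ n) \<longlonglongrightarrow> l"
    using tendsto_diff[OF l const_div_4_tendsto] by simp
  have ml: "(\<lambda>n. ln (m n) / 4 ^ n) \<longlonglongrightarrow> l"
  proof (rule tendsto_sandwich[OF _ _ low l])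
    show "\<forall>\<^sub>F n in sequentially. ln (G n) / 4 ^ n - ln (1 + sqrt A) / 4 ^ n \<le> ln (m n) / 4 ^ n"
      using ln_m_bounds(2) by (intro always_eventually allI)
        (simp add: diff_divide_distrib[symmetric] divide_right_mono algebra_simps)
    show "\<forall>\<^sub>F n in sequentially. ln (m n) / 4 ^ n \<le> ln (G n) / 4 ^ n"
      using ln_m_bounds(1) by (intro always_eventually allI) (simp add: divide_right_mono)
  qed
  then have "L = l" unfolding L_def by (rule limI)
  with l ml show "(\<lambda>n. ln (m n) / 4 ^ n) \<longlonglongrightarrow> L" "(\<lambda>n. ln (G n) / 4 ^ n) \<longlonglongrightarrow> L" by simp_all
qed

lemma L_nonneg: "L \<ge> 0"
  by (rule LIMSEQ_le_const[OF tendsto_L(1)]) (use m_ge_1 in auto)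

lemma L_le_G: "L \<le> ln (G k) / 4 ^ k"
  using decseq_ge[OF ln_G_tendsto(2) tendsto_L(2)] .

text \<open>The factor 2 lost at each duplication costs ln 2 (1/4 + 1/16 + ...) = (ln 2)/3 in total.
  With this constant added, ln N at most quadruples per step.\<close>

lemma L_le_N:
  assumes "a < 0"
  shows "L \<le> (ln (N 0) + ln 2 / 3) / 2"
proof -
  have N: "ln (N n) + ln 2 / 3 \<le> 4 ^ n * (ln (N 0) + ln 2 / 3)" for n
  proof (induction n)
    case (Suc n)
    have "ln (N (Suc n)) \<le> ln (2 * N n ^ 4)"
      using N_Suc_le[OF assms, of n] N_ge_1[of "Suc n"] by (subst ln_le_cancel_iff) auto
    also have "\<dots> = ln 2 + 4 * ln (N n)"
      using N_ge_1[of n] by (subst ln_mult_pos) (auto simp: ln_realpow)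
    finally show ?case using Suc.IH by simp
  qed simp
  have "ln (m n) / 4 ^ n \<le> (ln (N 0) + ln 2 / 3) / 2" for n
  proof -
    have "ln (m n ^ 2) \<le> ln (N n)"
      using m_le_N[of n] m_ge_1[of n] N_ge_1[of n] by (subst ln_le_cancel_iff) auto
    then have "2 * ln (m n) \<le> ln (N n)"
      using m_ge_1[of n] by (simp add: ln_realpow)
    moreover have "0 \<le> ln (2 :: real) / 3" by simp
    ultimately have "2 * ln (m n) \<le> ln (N n) + ln 2 / 3" by linarith
    then have "2 * ln (m n) \<le> 4 ^ n * (ln (N 0) + ln 2 / 3)" using N[of n] by linarith
    then show ?thesis by (simp add: field_simps)
  qed
  then show ?thesis by (intro LIMSEQ_le_const2[OF tendsto_L(1)]) auto
qed

text \<open>\<open>b / c\<close> is \<open>x\<^sup>2 / a\<close> in lowest terms. In this coordinate duplication is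
  \<open>(b, c) \<mapsto> ((b - c)\<^sup>4, 16 b c (b + c)\<^sup>2)\<close>, free of \<open>a\<close>, and only its first application can involve
  a common factor.\<close>

definition rep :: "nat \<Rightarrow> int \<Rightarrow> int \<Rightarrow> bool" where
  "rep n b c \<longleftrightarrow> coprime b c \<and> (\<exists>k\<ge>1. s n ^ 2 = k * b \<and> a * t n ^ 2 = k * c)"

text \<open>Since s and t are coprime, the gcd of s^2 and a t^2 divides a; this is the only place
  where the upper bound loses a power of |a|.\<close>

lemma rep_exists: "\<exists>b c. rep n b c \<and> N n \<le> A * (\<bar>real_of_int b\<bar> + \<bar>real_of_int c\<bar>)"
proof -
  define g where "g = gcd (s n ^ 2) (a * t n ^ 2)"
  have g0: "g \<noteq> 0" using nonzero[of n] a0 by (auto simp: g_def)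
  then have g1: "g \<ge> 1" using gcd_ge_0_int[of "s n ^ 2" "a * t n ^ 2"] unfolding g_def by linarith
  obtain b c where bc: "s n ^ 2 = b * g" "a * t n ^ 2 = c * g" "coprime b c"
    using gcd_coprime_exists[of "s n ^ 2" "a * t n ^ 2"] g0 unfolding g_def by metis
  have "coprime (s n ^ 2) (t n ^ 2)" using cop by simp
  moreover have "g dvd s n ^ 2" "g dvd a * t n ^ 2" by (auto simp: g_def)
  ultimately have "g dvd a"
    by (meson coprime_dvd_mult_left_iff coprime_divisors dvd_refl)
  then have "g \<le> \<bar>a\<bar>" using a0 zdvd_imp_le[of g "\<bar>a\<bar>"] by simp
  then have gA: "real_of_int g \<le> A" unfolding A_def by linarith
  have "N n = real_of_int (s n ^ 2) + \<bar>real_of_int (a * t n ^ 2)\<bar>"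
    unfolding N_def A_def by (simp add: abs_mult)
  also have "\<dots> = real_of_int g * (\<bar>real_of_int b\<bar> + \<bar>real_of_int c\<bar>)"
  proof -
    have "real_of_int (s n ^ 2) = \<bar>real_of_int (b * g)\<bar>" unfolding bc(1)[symmetric] by simp
    then show ?thesis unfolding bc(2) using g1 by (simp add: abs_mult algebra_simps)
  qed
  also have "\<dots> \<le> A * (\<bar>real_of_int b\<bar> + \<bar>real_of_int c\<bar>)"
    using gA by (intro mult_right_mono) auto
  finally show ?thesis using bc g1 unfolding rep_def by (auto simp: mult.commute)
qed

lemma rep_le_N:
  assumes "rep n b c"
  shows "\<bar>real_of_int b\<bar> + \<bar>real_of_int c\<bar> \<le> N n"
proof -
  from assms obtain k where k: "k \<ge> 1" "s n ^ 2 = k * b" "a * t n ^ 2 = k * c"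
    unfolding rep_def by blast
  have "N n = \<bar>real_of_int (s n ^ 2)\<bar> + \<bar>real_of_int (a * t n ^ 2)\<bar>"
    unfolding N_def A_def by (simp add: abs_mult)
  also have "\<dots> = real_of_int k * (\<bar>real_of_int b\<bar> + \<bar>real_of_int c\<bar>)"
    unfolding k(2,3) using k(1) by (simp add: abs_mult algebra_simps)
  also have "\<dots> \<ge> 1 * (\<bar>real_of_int b\<bar> + \<bar>real_of_int c\<bar>)"
    using k(1) by (intro mult_right_mono) auto
  finally show ?thesis by simp
qed

text \<open>The factor \<open>d\<close> cancelled in the x-coordinates is uncontrolled but harmless:
  b' and c' are coprime, so d^2 divides k^4 e and the quotient becomes the new factor k'. Only
  \<open>e\<close> affects the growth of |b| + |c|.\<close>

lemma rep_Suc: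
  assumes "rep n b c"
  shows "\<exists>e b' c'. rep (Suc n) b' c' \<and> e \<le> 64 \<and> odd (b' + c') \<and> (odd (b + c) \<longrightarrow> e = 1) \<and>
    (\<bar>b\<bar> + \<bar>c\<bar>) ^ 4 \<le> e * (\<bar>b'\<bar> + \<bar>c'\<bar>)"
proof -
  from assms obtain k where k: "k \<ge> 1" "s n ^ 2 = k * b" "a * t n ^ 2 = k * c" and bc: "coprime b c"
    unfolding rep_def by blast
  from step[of n] obtain d where d: "d \<ge> 1" "(s n ^ 2 - a * t n ^ 2) ^ 2 = d * s (Suc n)"
    "4 * s n * t n * (s n ^ 2 + a * t n ^ 2) = d * t (Suc n)" by blast
  from coprime_dup[OF bc] obtain e b' c' where e: "(b - c) ^ 4 = e * b'"
    "16 * b * c * (b + c) ^ 2 = e * c'" "coprime b' c'" "odd (b' + c')" "1 \<le> e" "e \<le> 64"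
    "odd (b + c) \<longrightarrow> e = 1" by blast
  have "(d * s (Suc n)) ^ 2 = k ^ 4 * (b - c) ^ 4"
    unfolding d(2)[symmetric] k(2,3) by algebra
  then have S: "d ^ 2 * s (Suc n) ^ 2 = k ^ 4 * e * b'" unfolding e(1) by (simp add: power_mult_distrib)
  have "a * (d * t (Suc n)) ^ 2 = 16 * s n ^ 2 * (a * t n ^ 2) * (s n ^ 2 + a * t n ^ 2) ^ 2"
    unfolding d(3)[symmetric] by algebra
  also have "\<dots> = k ^ 4 * (16 * b * c * (b + c) ^ 2)"
    unfolding k(2,3) by algebra
  finally have T: "d ^ 2 * (a * t (Suc n) ^ 2) = k ^ 4 * e * c'"
    unfolding e(2) by (simp add: power_mult_distrib algebra_simps)
  have "d ^ 2 dvd gcd (k ^ 4 * e * b') (k ^ 4 * e * c')"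
    unfolding S[symmetric] T[symmetric] by simp
  also have "gcd (k ^ 4 * e * b') (k ^ 4 * e * c') = \<bar>k ^ 4 * e\<bar>"
    using e(3) by (subst gcd_mult_distrib_int[symmetric]) (simp add: coprime_iff_gcd_eq_1)
  finally obtain k' where k': "k ^ 4 * e = d ^ 2 * k'" by auto
  have "k ^ 4 * e > 0" using k(1) e(5) by simp
  then have "k' > 0" using k' d(1) by (simp add: zero_less_mult_iff)
  have "s (Suc n) ^ 2 = k' * b'" "a * t (Suc n) ^ 2 = k' * c'"
    using S T d(1) unfolding k' by simp_all
  with \<open>k' > 0\<close> e(3) have "rep (Suc n) b' c'" unfolding rep_def by (auto intro!: exI[of _ k'])
  moreover have "(\<bar>b\<bar> + \<bar>c\<bar>) ^ 4 \<le> e * (\<bar>b'\<bar> + \<bar>c'\<bar>)"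
    using abs_sum_dup_ge[of b c] e(5) unfolding e(1,2) by (simp add: abs_mult algebra_simps)
  ultimately show ?thesis using e by blast
qed

lemma rep_iterate:
  assumes "rep n b c" "odd (b + c)"
  shows "\<exists>b' c'. rep (n + j) b' c' \<and> odd (b' + c') \<and> (\<bar>b\<bar> + \<bar>c\<bar>) ^ (4 ^ j) \<le> \<bar>b'\<bar> + \<bar>c'\<bar>"
proof (induction j)
  case 0
  then show ?case using assms by auto
next
  case (Suc j)
  then obtain b' c' where IH: "rep (n + j) b' c'" "odd (b' + c')"
    "(\<bar>b\<bar> + \<bar>c\<bar>) ^ (4 ^ j) \<le> \<bar>b'\<bar> + \<bar>c'\<bar>" by blast
  from rep_Suc[OF IH(1)] IH(2) obtain b'' c'' where
    n: "rep (Suc (n + j)) b'' c''" "odd (b'' + c'')" "(\<bar>b'\<bar> + \<bar>c'\<bar>) ^ 4 \<le> \<bar>b''\<bar> + \<bar>c''\<bar>"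
    by auto
  have "((\<bar>b\<bar> + \<bar>c\<bar>) ^ (4 ^ j)) ^ 4 \<le> (\<bar>b'\<bar> + \<bar>c'\<bar>) ^ 4"
    using IH(3) by (intro power_mono) auto
  then have "(\<bar>b\<bar> + \<bar>c\<bar>) ^ (4 ^ Suc j) \<le> \<bar>b''\<bar> + \<bar>c''\<bar>"
    using n(3) by (simp add: mult.commute flip: power_mult)
  then show ?case using n by auto
qed

lemma L_ge: "L \<ge> (ln (N 0) - ln A) / 2 - 3 / 4 * ln 2"
proof -
  obtain b c where bc: "rep 0 b c" "N 0 \<le> A * (\<bar>real_of_int b\<bar> + \<bar>real_of_int c\<bar>)"
    using rep_exists by blast
  obtain e b1 c1 where r1: "rep (Suc 0) b1 c1" "e \<le> 64" "odd (b1 + c1)"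
    "(\<bar>b\<bar> + \<bar>c\<bar>) ^ 4 \<le> e * (\<bar>b1\<bar> + \<bar>c1\<bar>)"
    using rep_Suc[OF bc(1)] by blast
  define M0 M1 where "M0 = real_of_int (\<bar>b\<bar> + \<bar>c\<bar>)" and "M1 = real_of_int (\<bar>b1\<bar> + \<bar>c1\<bar>)"
  have "b \<noteq> 0 \<or> c \<noteq> 0" "b1 \<noteq> 0 \<or> c1 \<noteq> 0" using bc(1) r1(1) unfolding rep_def by auto
  then have M: "M0 \<ge> 1" "M1 \<ge> 1" unfolding M0_def M1_def by linarith+
  have "e * (\<bar>b1\<bar> + \<bar>c1\<bar>) \<le> 64 * (\<bar>b1\<bar> + \<bar>c1\<bar>)" using r1(2) by (intro mult_right_mono) auto
  with r1(4) have "(\<bar>b\<bar> + \<bar>c\<bar>) ^ 4 \<le> 64 * (\<bar>b1\<bar> + \<bar>c1\<bar>)" by linarith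
  then have "real_of_int ((\<bar>b\<bar> + \<bar>c\<bar>) ^ 4) \<le> real_of_int (64 * (\<bar>b1\<bar> + \<bar>c1\<bar>))"
    by (simp only: of_int_le_iff)
  then have "M0 ^ 4 \<le> 64 * M1" unfolding M0_def M1_def by simp
  then have "ln (M0 ^ 4) \<le> ln (64 * M1)" using M by (subst ln_le_cancel_iff) auto
  moreover have "ln (64 :: real) = 6 * ln 2" using ln_realpow[of "2 :: real" 6] by simp
  ultimately have lnM: "4 * ln M0 \<le> 6 * ln 2 + ln M1"
    using M by (simp add: ln_realpow ln_mult_pos)
  have "ln (N 0) \<le> ln (A * M0)"
    using bc(2) N_ge_1[of 0] M A_ge_1 unfolding M0_def by (subst ln_le_cancel_iff) auto
  also have "\<dots> = ln A + ln M0" using M A_ge_1 by (intro ln_mult_pos) auto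
  finally have lnN: "ln (N 0) \<le> ln A + ln M0" .
  \<comment> \<open>The cancellation-free chain starts at 2P, so at index \<open>j + 1\<close> it
    has run only j steps; hence the quarter of \<open>ln M1\<close>.\<close>
  have ev: "ln M1 / 4 \<le> ln (1 + A) / 4 ^ (j + 1) + 2 * (ln (m (j + 1)) / 4 ^ (j + 1))" for j
  proof -
    obtain b' c' where r: "rep (Suc 0 + j) b' c'" "(\<bar>b1\<bar> + \<bar>c1\<bar>) ^ (4 ^ j) \<le> \<bar>b'\<bar> + \<bar>c'\<bar>"
      using rep_iterate[OF r1(1,3)] by blast
    have "real_of_int ((\<bar>b1\<bar> + \<bar>c1\<bar>) ^ (4 ^ j)) \<le> real_of_int (\<bar>b'\<bar> + \<bar>c'\<bar>)"
      using r(2) by (simp only: of_int_le_iff)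
    then have "M1 ^ (4 ^ j) \<le> \<bar>real_of_int b'\<bar> + \<bar>real_of_int c'\<bar>" unfolding M1_def by simp
    also have "\<dots> \<le> N (j + 1)" using rep_le_N[OF r(1)] by simp
    also have "\<dots> \<le> (1 + A) * m (j + 1) ^ 2" by (rule N_le_m)
    finally have "ln (M1 ^ (4 ^ j)) \<le> ln ((1 + A) * m (j + 1) ^ 2)"
      using M m_ge_1[of "j + 1"] A_ge_1 by (subst ln_le_cancel_iff) auto
    also have "\<dots> = ln (1 + A) + 2 * ln (m (j + 1))"
      using m_ge_1[of "j + 1"] A_ge_1 by (subst ln_mult_pos) (auto simp: ln_realpow)
    finally have "4 ^ j * ln M1 \<le> ln (1 + A) + 2 * ln (m (j + 1))"
      using M by (simp add: ln_realpow)
    then show ?thesis by (simp add: field_simps)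
  qed
  have "(\<lambda>j. ln (1 + A) / 4 ^ (j + 1) + 2 * (ln (m (j + 1)) / 4 ^ (j + 1))) \<longlonglongrightarrow> 0 + 2 * L"
    by (intro tendsto_add tendsto_mult tendsto_const LIMSEQ_ignore_initial_segment
        const_div_4_tendsto tendsto_L)
  then have "ln M1 / 4 \<le> 0 + 2 * L"
    using ev by (intro LIMSEQ_le_const) auto
  then show ?thesis using lnM lnN by (simp add: field_simps)
qed

end

section \<open>Heights of rational points\<close>

text \<open>With 1/0 for O, the height formula and the duplication relation hold without exception
  at infinity.\<close>

fun coords :: "rat ec_point \<Rightarrow> int \<times> int" where
  "coords Infinity = (1, 0)"
| "coords (Affine x y) = quotient_of x"

lemma coords_coprime: "coords P = (u, v) \<Longrightarrow> coprime u v"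
  by (cases P) (auto simp: quotient_of_coprime)

lemma naive_height_coords:
  "coords P = (u, v) \<Longrightarrow> naive_height P = ln (real_of_int (max \<bar>u\<bar> \<bar>v\<bar>))"
  by (cases P) (auto simp: rat_height_def)

lemma coords_Affine:
  assumes "coords (Affine x y) = (s, t)" "y ^ 2 = x ^ 3 + of_int a * x"
  shows "t > 0" "x = of_int s / of_int t"
    "(y * of_int t ^ 2) ^ 2 = of_int (s * t * (s ^ 2 + a * t ^ 2))"
proof -
  show t: "t > 0" using assms(1) by (auto dest: quotient_of_denom_pos)
  show x: "x = of_int s / of_int t" using assms(1) by (auto dest: quotient_of_div)
  define S T :: rat where "S = of_int s" and "T = of_int t"
  have T: "T \<noteq> 0" using t by (simp add: T_def)
  have s: "S = x * T" using x T by (simp add: S_def T_def)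
  have "(y * T ^ 2) ^ 2 = S * T * (S ^ 2 + of_int a * T ^ 2)"
    unfolding s using assms(2) by algebra
  then show "(y * of_int t ^ 2) ^ 2 = of_int (s * t * (s ^ 2 + a * t ^ 2))"
    by (simp add: S_def T_def)
qed

lemma ec_double_x:
  fixes a :: "'a :: field_char_0"
  assumes "Affine x y \<in> ec_points a" "y \<noteq> 0"
  obtains x' y' where "ec_add a (Affine x y) (Affine x y) = Affine x' y'"
    "4 * y ^ 2 * x' = (x ^ 2 - a) ^ 2"
proof -
  define l where "l = (3 * x ^ 2 + a) / (2 * y)"
  have "y \<noteq> - y" using assms(2) by (metis add_eq_0_iff2 mult_2 mult_eq_0_iff zero_neq_numeral)
  then have "ec_add a (Affine x y) (Affine x y) = Affine (l ^ 2 - x - x) (l * (x - (l ^ 2 - x - x)) - y)"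
    by (simp add: ec_add.simps(3) l_def Let_def)
  moreover have "2 * y * l = 3 * x ^ 2 + a" using assms(2) by (simp add: l_def)
  then have "4 * y ^ 2 * (l ^ 2 - x - x) = (x ^ 2 - a) ^ 2"
    using assms(1) unfolding Affine_in_ec_points by algebra
  ultimately show thesis using that by blast
qed

lemma coords_double:
  assumes a0: "a \<noteq> 0" and P: "P \<in> ec_points (rat_of_int a)"
    and st: "coords P = (s, t)" and st': "coords (ec_add (of_int a) P P) = (s', t')"
  shows "\<exists>d\<ge>1. (s ^ 2 - a * t ^ 2) ^ 2 = d * s' \<and> 4 * s * t * (s ^ 2 + a * t ^ 2) = d * t'"
proof (cases P)
  case Infinity
  then show ?thesis using st st' by auto
next
  case (Affine x y)
  have curve: "y ^ 2 = x ^ 3 + of_int a * x" using P Affine by (simp add: Affine_in_ec_points)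
  note c = coords_Affine[OF st[unfolded Affine] curve]
  show ?thesis
  proof (cases "y = 0")
    case True
    then have st'': "s' = 1" "t' = 0" using st' Affine by (auto simp: ec_add.simps(3))
    have z: "s * (s ^ 2 + a * t ^ 2) = 0" using c(1,3) True by (simp flip: of_int_mult of_int_add of_int_power)
    \<comment> \<open>At a 2-torsion point the double is 1/0, so the first form itself serves as the
      cancelled factor and has to be nonzero.\<close>
    have "s ^ 2 - a * t ^ 2 \<noteq> 0"
    proof
      assume "s ^ 2 - a * t ^ 2 = 0"
      then have at: "a * t ^ 2 = s ^ 2" by simp
      with z have "s = 0" by simp
      with at a0 c(1) show False by simp
    qed
    then have "(s ^ 2 - a * t ^ 2) ^ 2 > 0" by simp
    then have "(s ^ 2 - a * t ^ 2) ^ 2 \<ge> 1" by linarith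
    moreover have "4 * s * t * (s ^ 2 + a * t ^ 2) = 0" using z by auto
    ultimately show ?thesis unfolding st'' by (intro exI[of _ "(s ^ 2 - a * t ^ 2) ^ 2"]) simp
  next
    case False
    obtain x' y' where dbl: "ec_add (of_int a) (Affine x y) (Affine x y) = Affine x' y'"
      "4 * y ^ 2 * x' = (x ^ 2 - of_int a) ^ 2"
      using ec_double_x P Affine False by metis
    have q: "quotient_of x' = (s', t')" using st' Affine dbl by simp
    have t': "t' > 0" using q by (rule quotient_of_denom_pos)
    have x': "x' = of_int s' / of_int t'" using q by (rule quotient_of_div)
    define S T where "S = (s ^ 2 - a * t ^ 2) ^ 2" and "T = 4 * s * t * (s ^ 2 + a * t ^ 2)"
    \<comment> \<open>The denominator before cancellation is four times a rational square, which
      makes the cancelled factor positive.\<close>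
    have T: "of_int T = 4 * (y * of_int t ^ 2) ^ 2" unfolding c(3) by (simp add: T_def)
    then have "(of_int T :: rat) > 0" using False c(1) by simp
    then have T0: "T > 0" by simp
    have xt: "x * of_int t = of_int s" using c(1,2) by simp
    have "of_int T * x' = (4 * y ^ 2 * x') * of_int t ^ 4"
      unfolding T by algebra
    also have "\<dots> = ((x * of_int t) ^ 2 - of_int a * of_int t ^ 2) ^ 2"
      unfolding dbl(2) by algebra
    also have "\<dots> = of_int S" unfolding xt by (simp add: S_def)
    finally have "of_int T * (of_int s' :: rat) = of_int S * of_int t'"
      using t' by (simp add: x' field_simps)
    then have TS: "T * s' = S * t'" by (simp flip: of_int_mult)
    have "coprime t' s'" using quotient_of_coprime[OF q] by (simp add: coprime_commute)
    moreover have "t' dvd T * s'" using TS by simp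
    ultimately have "t' dvd T" by (simp add: coprime_dvd_mult_left_iff)
    then obtain d where d: "T = d * t'" by (metis dvd_div_mult_self)
    have "d > 0" using T0 t' d by (simp add: zero_less_mult_iff)
    moreover have "S = d * s'" using TS d t' by simp
    ultimately show ?thesis using d unfolding S_def T_def by (intro exI[of _ d]) auto
  qed
qed

section \<open>Rational points for a = 1, 2, -1\<close>

lemma rat_square_of_int:
  assumes "(z :: rat) ^ 2 = of_int n"
  shows "\<exists>w. n = w ^ 2"
proof -
  obtain u v where q: "quotient_of z = (u, v)" by fastforce
  have v: "v > 0" and z: "z = of_int u / of_int v" and cop: "coprime u v"
    using quotient_of_denom_pos[OF q] quotient_of_div[OF q] quotient_of_coprime[OF q] by auto
  have "of_int u ^ 2 = (of_int n * of_int v ^ 2 :: rat)"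
    using assms v unfolding z by (simp add: field_simps)
  then have uv: "u ^ 2 = n * v ^ 2" by (metis (mono_tags) of_int_eq_iff of_int_mult of_int_power)
  then have "v ^ 2 dvd u ^ 2" by simp
  then have "v dvd u" by simp
  with cop have "is_unit v" using coprime_common_divisor[of u v v] by simp
  with v have "v = 1" by simp
  with uv show ?thesis by auto
qed

lemma is_square_abs_mult:
  fixes x y w :: int
  assumes "x * y = w ^ 2" "coprime x y"
  shows "\<exists>p q :: nat. \<bar>x\<bar> = int p ^ 2 \<and> \<bar>y\<bar> = int q ^ 2"
proof -
  have "nat \<bar>x\<bar> * nat \<bar>y\<bar> = nat \<bar>w\<bar> ^ 2"
    unfolding nat_abs_mult_distrib[symmetric] assms(1) by (simp only: power_abs nat_power_eq abs_ge_zero)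
  moreover have "coprime (nat \<bar>x\<bar>) (nat \<bar>y\<bar>)" using assms(2) by (simp flip: coprime_int_iff)
  ultimately have "is_square (nat \<bar>x\<bar>)" "is_square (nat \<bar>y\<bar>)"
    using is_nth_power_mult_coprime_nat_iff[of "nat \<bar>x\<bar>" "nat \<bar>y\<bar>" 2] by auto
  then obtain p q where "nat \<bar>x\<bar> = p ^ 2" "nat \<bar>y\<bar> = q ^ 2" by (auto simp: is_nth_power_def)
  then show ?thesis by (metis abs_ge_zero int_nat_eq of_nat_power)
qed

text \<open>Coprimality of t and s (s^2 + a t^2) gives t = e^2. If s is coprime to a, then |s| = p^2
  and |p^4 + a e^4| is a nonzero square, contradicting a quartic descent. Otherwise a = 2 and s = 2
  h is even, and removing a factor 4 leads to e^4 + 2 p^4 = r^2 with |h| = p^2.\<close>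

lemma square_eq_imp_two_torsion:
  fixes s t w a :: int
  assumes eq: "s * t * (s ^ 2 + a * t ^ 2) = w ^ 2" and cop: "coprime s t" and t: "t > 0"
    and a: "a \<in> {1, 2, - 1}"
  shows "w = 0"
proof (rule ccontr)
  assume w: "w \<noteq> 0"
  have s0: "s \<noteq> 0" and r0: "s ^ 2 + a * t ^ 2 \<noteq> 0" using eq w by auto
  have "coprime t (a * t * t + s * s)" unfolding coprime_iff_gcd_eq_1 gcd_add_mult
    using cop by (simp add: coprime_commute flip: coprime_iff_gcd_eq_1)
  then have "coprime t (s ^ 2 + a * t ^ 2)" by (simp add: power2_eq_square mult.assoc add.commute)
  then have "coprime t (s * (s ^ 2 + a * t ^ 2))" using cop by (simp add: coprime_commute)
  moreover have "t * (s * (s ^ 2 + a * t ^ 2)) = w ^ 2" using eq by (simp add: mult_ac)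
  ultimately obtain e f :: nat where "\<bar>t\<bar> = int e ^ 2" and f: "\<bar>s * (s ^ 2 + a * t ^ 2)\<bar> = int f ^ 2"
    using is_square_abs_mult by blast
  then have e: "t = int e ^ 2" using t by simp
  then have "e > 0" using t by (cases e) auto
  have "s * (s ^ 2 + a * t ^ 2) > 0"
  proof -
    have "t * (s * (s ^ 2 + a * t ^ 2)) > 0" using eq w by (simp add: mult_ac)
    then show ?thesis using t by (simp add: zero_less_mult_iff)
  qed
  with f have f: "s * (s ^ 2 + a * t ^ 2) = int f ^ 2" by simp
  have "coprime s (s ^ 2 + a * t ^ 2) \<longleftrightarrow> coprime s (a * t ^ 2)"
    unfolding power2_eq_square[of s] coprime_iff_gcd_eq_1 gcd_add_mult ..
  then have csa: "coprime s (s ^ 2 + a * t ^ 2) \<longleftrightarrow> coprime s a" using cop by simp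
  show False
  proof (cases "coprime s a")
    case True
    then obtain p r :: nat where pr: "\<bar>s\<bar> = int p ^ 2" "\<bar>s ^ 2 + a * t ^ 2\<bar> = int r ^ 2"
      using is_square_abs_mult[OF f] csa by blast
    have "p > 0" using pr s0 by (cases p) auto
    have "r > 0" using pr r0 by (cases r) auto
    have "s ^ 2 = (int p ^ 2) ^ 2" using pr(1) by (metis power2_abs)
    then have "\<bar>(int p ^ 2) ^ 2 + a * (int e ^ 2) ^ 2\<bar> = int r ^ 2" using pr(2) e by simp
    then have R: "\<bar>int (p ^ 4) + a * int (e ^ 4)\<bar> = int (r ^ 2)" by simp
    consider "a = 1" | "a = 2" | "a = - 1" using a by blast
    then show False
    proof cases
      case 1
      then have "int (p ^ 4 + 2 ^ 0 * e ^ 4) = int (r ^ 2)" using R by simp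
      then have "p ^ 4 + 2 ^ 0 * e ^ 4 = r ^ 2" by (simp only: of_nat_eq_iff)
      then show False using quartic_sum_not_square \<open>p > 0\<close> \<open>e > 0\<close> by blast
    next
      case 2
      then have "int (p ^ 4 + 2 ^ 1 * e ^ 4) = int (r ^ 2)" using R by simp
      then have "p ^ 4 + 2 ^ 1 * e ^ 4 = r ^ 2" by (simp only: of_nat_eq_iff)
      then show False using quartic_sum_not_square[of p 1 e r] \<open>p > 0\<close> \<open>e > 0\<close> by simp
    next
      case 3
      then have "int (p ^ 4) + a * int (e ^ 4) = int (p ^ 4) - int (e ^ 4)" by simp
      then have "int (p ^ 4) = int (e ^ 4 + r ^ 2) \<or> int (e ^ 4) = int (p ^ 4 + r ^ 2)"
        using R by (simp only: of_nat_add) linarith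
      then have "p ^ 4 = e ^ 4 + r ^ 2 \<or> e ^ 4 = p ^ 4 + r ^ 2" by (simp only: of_nat_eq_iff)
      then show False using quartic_diff_not_square \<open>p > 0\<close> \<open>e > 0\<close> \<open>r > 0\<close> by blast
    qed
  next
    case False
    then have a2: "a = 2" using a by auto
    with False have "even s" by simp
    then obtain h where h: "s = 2 * h" by blast
    have "odd t" using cop \<open>even s\<close> coprime_common_divisor[of s t 2] by auto
    have "4 * (h * (2 * h ^ 2 + t ^ 2)) = int f ^ 2"
      using f unfolding h a2 by (simp add: power_mult_distrib algebra_simps)
    moreover from this have "even (int f ^ 2)" by (metis dvd_mult2 even_numeral)
    then have "even (int f)" by simp
    then obtain g where "int f = 2 * g" by blast
    ultimately have g: "h * (2 * h ^ 2 + t ^ 2) = g ^ 2" by (simp add: power_mult_distrib)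
    have "gcd h (2 * h * h + t ^ 2) = gcd h (t ^ 2)" by (rule gcd_add_mult)
    moreover have "coprime h (t ^ 2)" using cop h by simp
    ultimately have "coprime h (2 * h ^ 2 + t ^ 2)"
      by (simp add: coprime_iff_gcd_eq_1 power2_eq_square mult.assoc)
    then obtain p r :: nat where pr: "\<bar>h\<bar> = int p ^ 2" "\<bar>2 * h ^ 2 + t ^ 2\<bar> = int r ^ 2"
      using is_square_abs_mult[OF g] by blast
    have "p > 0" using pr s0 h by (cases p) auto
    have "h ^ 2 = (int p ^ 2) ^ 2" using pr(1) by (metis power2_abs)
    moreover have "\<bar>2 * h ^ 2 + t ^ 2\<bar> = 2 * h ^ 2 + t ^ 2" by simp
    ultimately have "int (e ^ 4 + 2 ^ 1 * p ^ 4) = int (r ^ 2)" using pr(2) e by simp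
    then have "e ^ 4 + 2 ^ 1 * p ^ 4 = r ^ 2" by (simp only: of_nat_eq_iff)
    then show False using quartic_sum_not_square[of e 1 p r] \<open>p > 0\<close> \<open>e > 0\<close> by simp
  qed
qed

text \<open>Real points near \<open>x = 1\<close> violate the archimedean estimate behind the second lower bound when
  \<open>a = 1\<close>; it survives because the rational points are all \<open>2\<close>-torsion.\<close>

lemma double_eq_Infinity:
  assumes "a \<in> {1, 2, - 1}" "P \<in> ec_points (rat_of_int a)"
  shows "ec_add (of_int a) P P = Infinity"
proof (cases P)
  case (Affine x y)
  obtain s t where st: "coords (Affine x y) = (s, t)" by fastforce
  have "y ^ 2 = x ^ 3 + of_int a * x" using assms(2) Affine by (simp add: Affine_in_ec_points)
  note c = coords_Affine[OF st this]
  obtain w where w: "s * t * (s ^ 2 + a * t ^ 2) = w ^ 2" using rat_square_of_int[OF c(3)] by blast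
  have "w = 0"
    by (rule square_eq_imp_two_torsion[OF w coords_coprime[OF st] c(1) assms(1)])
  with w have "s * t * (s ^ 2 + a * t ^ 2) = 0" by simp
  with c(1,3) have "y = 0" by simp
  then show ?thesis using Affine by (simp add: ec_add.simps(3))
qed auto

text \<open>Here 1.92 and 1.28 are 6 and 4 times 0.32, the double of the constant to be proved. The
  bases 1.1272 and 1.1728 are 1 + z + z^2/2 at z = 0.12 and z = 0.16, and 3.579 lies just below
  1.1728^8.\<close>

lemma ln_numeric_bounds: "ln (27 / 4 :: real) < 1.92" "ln (3.579 :: real) < 1.28"
proof -
  have "(27 / 4 :: real) < 1.1272 ^ 16" by (simp add: power_divide)
  also have "\<dots> \<le> exp 0.12 ^ 16"
    using exp_lower_Taylor_quadratic[of "0.12 :: real"] by (intro power_mono) (simp_all add: power2_eq_square)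
  also have "\<dots> = exp 1.92" by (simp flip: exp_of_nat_mult)
  finally show "ln (27 / 4 :: real) < 1.92" using ln_less_cancel_iff[of _ "exp 1.92"] by simp
  have "(3.579 :: real) < 1.1728 ^ 8" by (simp add: power_divide)
  also have "\<dots> \<le> exp 0.16 ^ 8"
    using exp_lower_Taylor_quadratic[of "0.16 :: real"] by (intro power_mono) (simp_all add: power2_eq_square)
  also have "\<dots> = exp 1.28" by (simp flip: exp_of_nat_mult)
  finally show "ln (3.579 :: real) < 1.28" using ln_less_cancel_iff[of _ "exp 1.28"] by simp
qed

section \<open>The height estimates at a rational point\<close>

locale int_elliptic =
  fixes a :: int and P :: "rat ec_point"
  assumes a_nonzero: "a \<noteq> 0" and P: "P \<in> ec_points (rat_of_int a)"
begin

sublocale rat_elliptic "rat_of_int a"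
  by standard (simp add: a_nonzero)

definition Q where "Q n = ec_mult (rat_of_int a) (2 ^ n) P"

lemma Q_0: "Q 0 = P" and Q_Suc: "Q (Suc n) = ec_add (of_int a) (Q n) (Q n)" and Q_in: "Q n \<in> ec_points (of_int a)"
  using P by (simp_all add: Q_def ec_mult_double ec_mult_closed del: power_Suc)

sublocale dup_seq a "\<lambda>n. fst (coords (Q n))" "\<lambda>n. snd (coords (Q n))"
proof
  show "a \<noteq> 0" by (fact a_nonzero)
  fix n
  show "coprime (fst (coords (Q n))) (snd (coords (Q n)))"
    by (rule coords_coprime[of "Q n"]) simp
  show "\<exists>d\<ge>1. ((fst (coords (Q n)))\<^sup>2 - a * (snd (coords (Q n)))\<^sup>2)\<^sup>2 = d * fst (coords (Q (Suc n))) \<and>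
      4 * fst (coords (Q n)) * snd (coords (Q n)) *
        ((fst (coords (Q n)))\<^sup>2 + a * (snd (coords (Q n)))\<^sup>2) = d * snd (coords (Q (Suc n)))"
    by (rule coords_double[OF a_nonzero Q_in]) (simp_all add: Q_Suc)
qed

lemma naive_height_Q: "naive_height (Q n) = ln (m n)"
  unfolding m_def by (rule naive_height_coords) simp

lemma canonical_height_eq: "canonical_height (rat_of_int a) P = L / 2"
  unfolding canonical_height_def L_def using naive_height_Q by (simp add: Q_def)

lemma naive_height_eq: "naive_height P = ln (m 0)"
  using naive_height_Q[of 0] by (simp add: Q_0)

lemma lower_bound:
  "- (1 / 4) * ln A - 1 / (2 * sqrt A) < 1 / 2 * naive_height P - canonical_height (rat_of_int a) P"
proof -
  have s: "sqrt A \<ge> 1" using A_ge_1 by simp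
  have "1 + sqrt A = sqrt A * (1 + 1 / sqrt A)" using s by (simp add: field_simps)
  then have "ln (1 + sqrt A) = ln (sqrt A) + ln (1 + 1 / sqrt A)"
    using s by (simp only:) (subst ln_mult_pos, auto intro!: add_pos_nonneg)
  also have "ln (1 + 1 / sqrt A) < 1 / sqrt A"
    using s by (intro ln_add_one_self_less_self) auto
  also have "ln (sqrt A) = ln A / 2" using A_ge_1 by (simp add: ln_sqrt)
  finally have "ln (1 + sqrt A) < ln A / 2 + 1 / sqrt A" by simp
  moreover have "L \<le> ln (1 + sqrt A) + ln (m 0)"
    using L_le_G[of 0] ln_m_bounds(2)[of 0] by simp
  ultimately show ?thesis
    unfolding canonical_height_eq naive_height_eq by simp
qed

text \<open>Strictness comes from m^2 < N, which needs both coordinates nonzero. If one of them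
  vanishes, coprimality gives m = 1, and nonnegativity of the canonical height suffices.\<close>

lemma upper_bound:
  "1 / 2 * naive_height P - canonical_height (rat_of_int a) P < 1 / 4 * ln A + 3 / 8 * ln 2"
proof (cases "m 0 = 1")
  case True
  have "ln A \<ge> 0" using A_ge_1 by simp
  moreover have "ln (2 :: real) > 0" by simp
  ultimately have "0 < 1 / 4 * ln A + 3 / 8 * ln 2" by linarith
  then show ?thesis
    using L_nonneg True unfolding canonical_height_eq naive_height_eq by simp
next
  case False
  define u v where "u = fst (coords (Q 0))" and "v = snd (coords (Q 0))"
  have "u \<noteq> 0 \<and> v \<noteq> 0"
  proof (rule ccontr)
    assume "\<not> (u \<noteq> 0 \<and> v \<noteq> 0)"
    then have "max \<bar>u\<bar> \<bar>v\<bar> = 1" using cop[of 0] by (auto simp: u_def v_def)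
    with False show False by (simp add: m_def u_def v_def)
  qed
  then have uv: "real_of_int u ^ 2 > 0" "real_of_int v ^ 2 > 0" by auto
  moreover have "A * real_of_int v ^ 2 \<ge> 1 * real_of_int v ^ 2"
    using A_ge_1 by (intro mult_right_mono) auto
  moreover have "m 0 ^ 2 = real_of_int u ^ 2 \<or> m 0 ^ 2 = real_of_int v ^ 2"
    using m_cases[of 0] unfolding u_def v_def by (metis power2_abs)
  ultimately have "m 0 ^ 2 < N 0" unfolding N_def u_def v_def by linarith
  then have "ln (m 0 ^ 2) < ln (N 0)"
    using m_ge_1[of 0] N_ge_1[of 0] by (subst ln_less_cancel_iff) auto
  then have "2 * ln (m 0) < ln (N 0)" using m_ge_1[of 0] by (simp add: ln_realpow)
  with L_ge have "ln (m 0) - L < ln A / 2 + 3 / 4 * ln 2" by argo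
  then show ?thesis unfolding canonical_height_eq naive_height_eq by simp
qed

text \<open>From A >= 2 follows 1 + A <= 3/2 A, so the loss is half of ln(3/2) + (ln 2)/3, that is
  ln(27/4)/6.\<close>

lemma lower_bound_uniform_neg:
  assumes "a \<le> - 2"
  shows "L < ln (m 0) + ln A / 2 + 0.32"
proof -
  have A2: "A \<ge> 2" using assms by (simp add: A_def)
  have "N 0 \<le> (1 + A) * m 0 ^ 2" by (rule N_le_m)
  also have "\<dots> \<le> (3 / 2 * A) * m 0 ^ 2" using A2 by (intro mult_right_mono) auto
  finally have "ln (N 0) \<le> ln ((3 / 2 * A) * m 0 ^ 2)"
    using N_ge_1[of 0] m_ge_1[of 0] A2 by (subst ln_le_cancel_iff) auto
  also have "\<dots> = ln (3 / 2 * A) + ln (m 0 ^ 2)"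
    using m_ge_1[of 0] A2 by (intro ln_mult_pos) auto
  also have "ln (3 / 2 * A) = ln (3 / 2) + ln A" using A2 by (intro ln_mult_pos) auto
  also have "ln (m 0 ^ 2) = 2 * ln (m 0)" using m_ge_1[of 0] by (simp add: ln_realpow)
  finally have N: "ln (N 0) \<le> ln (3 / 2) + ln A + 2 * ln (m 0)" .
  have "(27 / 4 :: real) = (3 / 2) ^ 3 * 2" by (simp add: power_divide)
  then have "ln (27 / 4 :: real) = 3 * ln (3 / 2) + ln 2"
    by (simp only:) (subst ln_mult_pos, simp_all add: ln_realpow)
  then show ?thesis using L_le_N N ln_numeric_bounds(1) assms by (simp add: field_simps)
qed

text \<open>The polynomial bounding \<open>G\<close> at 2P increases in both variables, so its
  maximum over |s|, |t| <= M is at the corner |s| = |t| = M. The estimate of L by a quarter of ln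
  G(2P) then sharpens the one by ln G(P).\<close>

lemma lower_bound_uniform_pos:
  assumes "a \<ge> 3"
  shows "L < ln (m 0) + ln A / 2 + 0.32"
proof -
  have A3: "A \<ge> 3" using assms by (simp add: A_def)
  define w where "w = sqrt A"
  have w: "w ^ 2 = A" "w > 0" using A3 by (simp_all add: w_def)
  define f where "f x u = (x ^ 2 - u ^ 2) ^ 2 + 4 * x * u * (x ^ 2 + u ^ 2)" for x u :: real
  have f_mono: "f x u \<le> f x u'" if "0 \<le> x" "0 \<le> u" "u \<le> u'" for x u u'
  proof -
    \<comment> \<open>The only negative term of the cofactor, -2 x^2 (u + u'), is absorbed by the
      squares of u - x/2 and u' - x/2.\<close>
    have "f x u' - f x u = (u' - u) * ((u + u') * (u ^ 2 + u' ^ 2) + 3 * x ^ 3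
        + 2 * x * (u ^ 2 + u * u' + u' ^ 2) + 2 * x * ((u - x / 2) ^ 2 + (u' - x / 2) ^ 2 + u * u'))"
      unfolding f_def by (simp add: power2_eq_square power3_eq_cube field_simps)
    then have "f x u' - f x u \<ge> 0" using that by simp
    then show ?thesis by simp
  qed
  have f_sym: "f x u = f u x" for x u unfolding f_def by algebra
  define M where "M = m 0"
  have M: "M \<ge> 1" unfolding M_def by (rule m_ge_1)
  have "G (Suc 0) \<le> f \<bar>real_of_int (fst (coords (Q 0)))\<bar> (w * \<bar>real_of_int (snd (coords (Q 0)))\<bar>)"
    using G_Suc_le_poly(1)[of 0] assms unfolding f_def w_def by simp
  also have "\<dots> \<le> f \<bar>real_of_int (fst (coords (Q 0)))\<bar> (w * M)"
    using w(2) m_ge(2)[of 0] unfolding M_def by (intro f_mono mult_left_mono) auto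
  also have "\<dots> \<le> f M (w * M)"
    unfolding f_sym[of _ "w * M"]
    using w(2) m_ge(1)[of 0] M unfolding M_def by (intro f_mono) auto
  also have "\<dots> = M ^ 4 * ((1 - A) ^ 2 + 4 * w * (1 + A))"
    unfolding f_def w(1)[symmetric] by algebra
  \<comment> \<open>Divided by A^2 the left side is about 3.52 at A = 3 and at most 7/2 from A = 4
    on. At A = 2 it is about 4.49, too large for the constant, which leaves a = 2 to the
    descent.\<close>
  also have "(1 - A) ^ 2 + 4 * w * (1 + A) \<le> 3.579 * A ^ 2"
  proof (cases "a = 3")
    case True
    have "A = 3" unfolding A_def using True by simp
    moreover have "w \<le> 1.7321" unfolding w_def \<open>A = 3\<close> by (rule real_le_lsqrt) (simp_all add: power2_eq_square)
    ultimately show ?thesis by simp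
  next
    case False
    then have A4: "A \<ge> 4" using assms by (simp add: A_def)
    have "2 \<le> w" unfolding w_def using A4 by (intro real_le_rsqrt) simp
    then have "2 * w \<le> w * w" using w(2) by (intro mult_right_mono) auto
    then have "2 * w \<le> A" using w(1) by (simp add: power2_eq_square)
    then have "2 * w * (2 * (1 + A)) \<le> A * (2 * (1 + A))" using A4 by (intro mult_right_mono) auto
    moreover have "4 * A \<le> A * A" using A4 by (intro mult_right_mono) auto
    moreover have "(1 - A) ^ 2 + 4 * w * (1 + A) = 1 - 2 * A + A * A + 2 * w * (2 * (1 + A))"
      "A * (2 * (1 + A)) = 2 * A + 2 * (A * A)"
      by algebra+
    ultimately have "(1 - A) ^ 2 + 4 * w * (1 + A) \<le> 7 / 2 * (A * A)" using A4 by linarith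
    also have "\<dots> \<le> 3.579 * A ^ 2" by (simp add: power2_eq_square)
    finally show ?thesis .
  qed
  finally have "G (Suc 0) \<le> M ^ 4 * (3.579 * A ^ 2)" using M by simp
  then have "ln (G (Suc 0)) \<le> ln (M ^ 4 * (3.579 * A ^ 2))"
    using M A3 G_ge_1[of "Suc 0"] by (subst ln_le_cancel_iff) auto
  also have "\<dots> = 4 * ln M + (ln 3.579 + 2 * ln A)"
  proof -
    have "ln (3.579 * A ^ 2) = ln 3.579 + ln (A ^ 2)" using A3 by (intro ln_mult_pos) auto
    moreover have "ln (M ^ 4 * (3.579 * A ^ 2)) = ln (M ^ 4) + ln (3.579 * A ^ 2)"
      using M A3 by (intro ln_mult_pos) auto
    ultimately show ?thesis using M A3 by (simp only: ln_realpow)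
  qed
  finally show ?thesis
    using L_le_G[of "Suc 0"] ln_numeric_bounds(2) unfolding M_def by simp
qed

lemma L_eq_0_small:
  assumes "a \<in> {1, 2, - 1}"
  shows "L \<le> 0"
proof -
  have "Q (Suc 0) = Infinity" using double_eq_Infinity[OF assms Q_in] Q_Suc by simp
  then have "G (Suc 0) = 1" by (simp add: G_def)
  then show ?thesis using L_le_G[of "Suc 0"] by simp
qed

lemma lower_bound_uniform:
  "- (1 / 4) * ln A - 0.16 < 1 / 2 * naive_height P - canonical_height (rat_of_int a) P"
proof -
  have "L < ln (m 0) + ln A / 2 + 0.32"
  proof (cases "a \<in> {1, 2, - 1}")
    case True
    have "ln (m 0) \<ge> 0" "ln A \<ge> 0" using m_ge_1[of 0] A_ge_1 by auto
    moreover have "(0 :: real) < 0.32" by simp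
    ultimately show ?thesis using L_eq_0_small[OF True] by linarith
  next
    case False
    then have "a \<le> - 2 \<or> a \<ge> 3" using a_nonzero by auto
    then show ?thesis using lower_bound_uniform_neg lower_bound_uniform_pos by blast
  qed
  then show ?thesis unfolding canonical_height_eq naive_height_eq by simp
qed

end

theorem theorem1p5:
  fixes a :: int
  assumes "a \<noteq> 0"
  shows "(\<forall>P \<in> ec_points (rat_of_int a).
           - (1 / 4) * ln \<bar>real_of_int a\<bar> - 1 / (2 * sqrt \<bar>real_of_int a\<bar>)
             < 1 / 2 * naive_height P - canonical_height (rat_of_int a) P
         \<and> 1 / 2 * naive_height P - canonical_height (rat_of_int a) P
             < 1 / 4 * ln \<bar>real_of_int a\<bar> + 3 / 8 * ln 2)
    \<and> (\<forall>P \<in> ec_points (rat_of_int a).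
           - (1 / 4) * ln \<bar>real_of_int a\<bar> - 0.16
             < 1 / 2 * naive_height P - canonical_height (rat_of_int a) P)"
proof -
  have "int_elliptic a P" if "P \<in> ec_points (rat_of_int a)" for P
    using that assms by (simp add: int_elliptic_def)
  note loc = this
  have "dup_seq.A a = \<bar>real_of_int a\<bar>" if "P \<in> ec_points (rat_of_int a)" for P
  proof -
    interpret int_elliptic a P by (rule loc[OF that])
    show ?thesis by (rule A_def)
  qed
  then show ?thesis
    using int_elliptic.lower_bound[OF loc] int_elliptic.upper_bound[OF loc]
      int_elliptic.lower_bound_uniform[OF loc] by metis
qed

end
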